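(* Let $K=\mathcal{M}(\mathbf{C})$ or $K=\mathbf{C}(\{z\})$ (the convergent case), and let $P=a_n\sigma_q^n+\cdots+a_0$ with $a_i\in K$, $a_0a_n\ne0$, all of whose slopes are integers. Let $\mu_k$ be the last (i.e. the largest) slope of $P$. Then the $q$-difference equation $P.f=a_n\sigma_q^nf+\cdots+a_0f=0$ admits $r_P(\mu_k)$ convergent solutions, i.e. solutions in $L$, that are linearly independent over the field of constants $C_L=L^{\sigma_q}$.
   Context: Fix $q\in\mathbf{C}$ with $|q|>1$. $\mathcal{M}(\mathbf{C})$ is the field of meromorphic functions on $\mathbf{C}$ and $\mathbf{C}(\{z\})$ the field of germs of meromorphic functions at $0$; $v_0$ is the $z$-adic valuation and $\sigma_q:f(z)\mapsto f(qz)$. If $K=\mathcal{M}(\mathbf{C})$, $L=\mathcal{M}(\mathbf{C}^* )$ is the field of meromorphic functions on $\mathbf{C}^*$; if $K=\mathbf{C}(\{z\})$, $L=\mathcal{M}(\mathbf{C}^*,0)$ is the field of germs at $0$ of meromorphic functions on punctured neighbourhoods of $0$ in $\mathbf{C}^*$. $\sigma_q$ acts on $L$ by $f(z)\mapsto f(qz)$, and $C_L$ is its fixed field (identified with the field of elliptic functions $\mathcal{M}(\mathbf{C}^*/q^{\mathbf{Z}})$). Newton polygon: $N(P)$ is the convex hull of $\{(i,j)\in\mathbf{Z}^2: j\ge v_0(a_i)\}$. Its boundary consists of two vertical half-lines and vectors $(r_1,d_1),\ldots,(r_k,d_k)\in\mathbf{N}^*\times\mathbf{Z}$ of slopes $\mu_i=d_i/r_i$,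 with $\mu_1<\cdots<\mu_k$. One sets $r_P(\mu_i)=r_i$. *)

theory Defs
  imports "HOL-Complex_Analysis.Complex_Analysis"
begin

text \<open>
  Elements of a field of meromorphic functions, or of germs of such, are represented by functions
  \<open>complex \<Rightarrow> complex\<close>. A family \<open>\<D>\<close> of domains selects the field: an element is a function that is
  meromorphic on some member of \<open>\<D>\<close>, and two functions are the same element if they agree on some
  member of \<open>\<D>\<close> outside a set without accumulation point in it (the library leaves the values of a
  meromorphic function unconstrained on such a set, in particular at its poles).
\<close>

definition mero :: "complex set set \<Rightarrow> (complex \<Rightarrow> complex) set" where
  "mero \<D> = {f. \<exists>U\<in>\<D>. f meromorphic_on U}"

definition mero_eq :: "complex set set \<Rightarrow> (complex \<Rightarrow> complex) \<Rightarrow> (complex \<Rightarrow> complex) \<Rightarrow> bool" where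
  "mero_eq \<D> f g \<longleftrightarrow> (\<exists>U\<in>\<D>. \<forall>\<^sub>\<approx>z\<in>U. f z = g z)"

text \<open>
  \<open>mero whole_plane\<close> is \<open>\<M>(\<complex>)\<close>, and \<open>mero nbhds_of_0\<close> is the field of meromorphic germs at 0.
  The corresponding fields of solutions are \<open>mero (punctured whole_plane)\<close>, the functions meromorphic
  on \<open>\<complex> - {0}\<close>, and \<open>mero (punctured nbhds_of_0)\<close>, the germs at 0 of functions meromorphic on a
  punctured neighbourhood of 0 (with no condition at 0 itself: poles may accumulate there).
\<close>

definition whole_plane :: "complex set set" where
  "whole_plane = {UNIV}"

definition nbhds_of_0 :: "complex set set" where
  "nbhds_of_0 = {U. open U \<and> 0 \<in> U}"

definition punctured :: "complex set set \<Rightarrow> complex set set" where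
  "punctured \<D> = (\<lambda>U. U - {0}) ` \<D>"

definition qshift :: "complex \<Rightarrow> (complex \<Rightarrow> complex) \<Rightarrow> (complex \<Rightarrow> complex)" where
  "qshift q f = (\<lambda>z. f (q * z))"

definition qdiff_op ::
    "complex \<Rightarrow> nat \<Rightarrow> (nat \<Rightarrow> complex \<Rightarrow> complex) \<Rightarrow> (complex \<Rightarrow> complex) \<Rightarrow> (complex \<Rightarrow> complex)" where
  "qdiff_op q n a f = (\<lambda>z. \<Sum>i\<le>n. a i z * ((qshift q ^^ i) f) z)"

definition q_constants :: "complex \<Rightarrow> complex set set \<Rightarrow> (complex \<Rightarrow> complex) set" where
  "q_constants q \<D> = {c \<in> mero \<D>. mero_eq \<D> (qshift q c) c}"

definition lin_indep_over_constants ::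
    "complex \<Rightarrow> complex set set \<Rightarrow> nat \<Rightarrow> (nat \<Rightarrow> complex \<Rightarrow> complex) \<Rightarrow> bool" where
  "lin_indep_over_constants q \<D> r f \<longleftrightarrow>
     (\<forall>c. (\<forall>j<r. c j \<in> q_constants q \<D>) \<and> mero_eq \<D> (\<lambda>z. \<Sum>j<r. c j z * f j z) (\<lambda>z. 0)
        \<longrightarrow> (\<forall>j<r. mero_eq \<D> (c j) (\<lambda>z. 0)))"

text \<open>The case distinction is needed because \<^const>\<open>zorder\<close> is unspecified for the zero germ.\<close>

definition v0 :: "(complex \<Rightarrow> complex) \<Rightarrow> ereal" where
  "v0 f = (if \<forall>\<^sub>F z in at 0. f z = 0 then \<infinity> else ereal (of_int (zorder f 0)))"

definition newton_polygon :: "nat \<Rightarrow> (nat \<Rightarrow> complex \<Rightarrow> complex) \<Rightarrow> (real \<times> real) set" where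
  "newton_polygon n a =
     convex hull {(real i, real_of_int j) | i j. i \<le> n \<and> v0 (a i) \<le> ereal (of_int j)}"

text \<open>
  The vectors \<open>(r, d)\<close> bounding the polygon: its bounded edges, oriented to the right. The two
  remaining edges are the vertical half-lines, which are not segments.
\<close>

definition newton_vectors :: "nat \<Rightarrow> (nat \<Rightarrow> complex \<Rightarrow> complex) \<Rightarrow> (nat \<times> int) set" where
  "newton_vectors n a =
     {(r, d). r > 0 \<and> (\<exists>p. closed_segment p (p + (real r, real_of_int d)) edge_of newton_polygon n a)}"

definition newton_slopes :: "nat \<Rightarrow> (nat \<Rightarrow> complex \<Rightarrow> complex) \<Rightarrow> real set" where
  "newton_slopes n a = {real_of_int d / real r | r d. (r, d) \<in> newton_vectors n a}"

definition slope_mult :: "nat \<Rightarrow> (nat \<Rightarrow> complex \<Rightarrow> complex) \<Rightarrow> real \<Rightarrow> nat" where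
  "slope_mult n a \<mu> = (THE r. \<exists>d. (r, d) \<in> newton_vectors n a \<and> \<mu> = real_of_int d / real r)"

end

theory Submission
  imports Defs "HOL-Computational_Algebra.Fundamental_Theorem_Algebra"
begin

text \<open>
  Multiplication by a power of the theta function, which satisfies \<open>\<theta>(q z) = z \<theta>(z)\<close>, tilts the
  Newton polygon so that the last slope becomes 0, of multiplicity \<open>r\<close>: after division by a power of
  \<open>z\<close>, all coefficients are holomorphic at 0, the leading one does not vanish there, and the
  polynomial \<open>\<Sum>i. a\<^sub>i(0) x ^ i\<close> has \<open>r\<close> nonzero roots. A root \<open>c\<close> of largest modulus is not
  resonant, and because of \<open>|q| > 1\<close> the formal solution \<open>e\<^sub>c * h\<close> with \<open>\<sigma>\<^sub>q e\<^sub>c = c e\<^sub>c\<close> and a power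
  series \<open>h\<close> converges. It allows to split off a right factor \<open>\<sigma>\<^sub>q - 1\<close> (up to conjugation), which
  lowers \<open>r\<close> by one. The remaining solutions are found by inverting \<open>\<sigma>\<^sub>q - 1\<close> on combinations of
  functions \<open>w * E * binomial(l, k)\<close> with \<open>\<sigma>\<^sub>q E = \<gamma> E\<close> and \<open>\<sigma>\<^sub>q l = l + 1\<close>; independence over the
  constants follows by applying \<open>\<sigma>\<^sub>q - 1\<close>. All this happens for germs at 0; if the coefficients are
  meromorphic on the whole plane, the functional equation extends the solutions to \<open>\<complex> - {0}\<close>.
\<close>

text \<open>Maximality of the modulus of \<open>c\<close> excludes all \<open>c * q ^ m\<close> with
  m >= 1 as roots, and these are exactly the values at which the recursion for the power series
  \<open>h\<close> breaks down. A smaller root may be resonant, so each stage treats one root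
  directly and passes to the quotient operator for the others. The price is an inhomogeneous
  equation for \<open>\<sigma>\<^sub>q - 1\<close> at every stage. On a twist with multiplier
  \<open>\<gamma>\<close> its only obstruction is a monomial \<open>z powi m\<close> with
  \<open>\<gamma> * q powi m = 1\<close>: the product of this monomial with the twist is invariant
  under \<open>\<sigma>\<^sub>q\<close>, and multiplying it by \<open>l\<close> gives the missing
  primitive. Repetition produces higher powers of \<open>l\<close>. Binomials are the suitable basis
  for them, because Pascal's rule reads
  \<open>(\<sigma>\<^sub>q - 1) (l gchoose Suc k) = l gchoose k\<close>.\<close>

section \<open>The last edge of the Newton polygon\<close>

lemma vertical_open_segment:
  fixes c x y e :: real
  assumes "c < y" "y < e"
  shows "(x, y) \<in> open_segment (x, c) (x, e)"
proof -
  define t where "t = (y - c) / (e - c)"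
  have "t * (e - c) = y - c" "0 < t" "t < 1" using assms by (auto simp: t_def)
  then show ?thesis
    unfolding in_segment using assms by (auto simp: algebra_simps intro!: exI[of _ t])
qed

text \<open>The chord point over \<open>x\<close> belongs to \<open>C\<close>. It differs from the
  extreme point, and it cannot lie below it: with \<open>(x, y + 1)\<close> in \<open>C\<close>, the
  extreme point would be interior to a vertical segment. The inequality is this comparison cleared
  of the denominator \<open>xv - xu\<close>.\<close>

lemma extreme_point_below_chord:
  fixes C :: "(real \<times> real) set"
  assumes "convex C" "(x, y) extreme_point_of C" "(x, y + 1) \<in> C"
    and "(xu, yu) \<in> C" "(xv, yv) \<in> C" "xu < x" "x < xv"
  shows "y * (xv - xu) < yu * (xv - x) + yv * (x - xu)"
proof (rule ccontr)
  define t where "t = (x - xu) / (xv - xu)"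
  define c where "c = (1 - t) * yu + t * yv"
  have t: "0 < t" "t < 1" using assms by (auto simp: t_def field_simps)
  have tx: "t * (xv - xu) = x - xu" using assms by (simp add: t_def)
  then have x: "x = (1 - t) * xu + t * xv" by (simp add: algebra_simps)
  have xc: "(x, c) \<in> open_segment (xu, yu) (xv, yv)"
    unfolding in_segment using t x assms by (auto simp: c_def intro!: exI[of _ t])
  then have xcC: "(x, c) \<in> C"
    using assms convex_contains_open_segment by blast
  have ceq: "c * (xv - xu) = yu * (xv - x) + yv * (x - xu)"
  proof -
    have "c * (xv - xu) = yu * (xv - xu) + (yv - yu) * (t * (xv - xu))"
      by (simp add: c_def algebra_simps)
    then show ?thesis unfolding tx by (simp add: algebra_simps)
  qed
  assume "\<not> ?thesis"
  then have "c * (xv - xu) \<le> y * (xv - xu)" using ceq by simp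
  then have "c \<le> y" using assms by simp
  moreover have "c \<noteq> y"
    using xc assms unfolding extreme_point_of_def by blast
  ultimately have "c < y" by simp
  then have "(x, y) \<in> open_segment (x, c) (x, y + 1)"
    by (intro vertical_open_segment) auto
  then show False
    using assms xcC unfolding extreme_point_of_def by blast
qed

text \<open>Abstract Newton data: \<open>I\<close> will be the indices of the nonzero coefficients
  and \<open>w\<close> their valuations. Restricting to \<open>I\<close> keeps \<infinity> out of
  the convex geometry.\<close>

definition lattice_above :: "nat set \<Rightarrow> (nat \<Rightarrow> int) \<Rightarrow> (real \<times> real) set" where
  "lattice_above I w = {(real i, real_of_int j) | i j. i \<in> I \<and> w i \<le> j}"

text \<open>A lattice point above the bottom of its column lies strictly between the bottom point
  and its upper neighbour, so it is not extreme.\<close>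

lemma extreme_point_lattice_above:
  assumes "x extreme_point_of convex hull lattice_above I w"
  obtains i where "i \<in> I" "x = (real i, real_of_int (w i))"
proof -
  have "x \<in> lattice_above I w"
    using assms extreme_point_of_convex_hull by blast
  then obtain i j where ij: "i \<in> I" "w i \<le> j" "x = (real i, real_of_int j)"
    by (auto simp: lattice_above_def)
  have "j = w i"
  proof (rule ccontr)
    assume "j \<noteq> w i"
    with ij have "w i < j" by simp
    then have "x \<in> open_segment (real i, real_of_int (w i)) (real i, real_of_int (j + 1))"
      unfolding ij by (intro vertical_open_segment) auto
    moreover have "(real i, real_of_int (w i)) \<in> convex hull lattice_above I w"
      "(real i, real_of_int (j + 1)) \<in> convex hull lattice_above I w"
      using ij by (auto simp: lattice_above_def intro!: hull_inc)
        (metis of_int_1 of_int_add add_increasing2 zero_le_one)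
    ultimately show False
      using assms unfolding extreme_point_of_def by blast
  qed
  with ij that show ?thesis by blast
qed

text \<open>A face of a face is a face, so both ends of an edge are extreme points and hence bottom
  points of their columns.\<close>

lemma edge_lattice_above:
  assumes "closed_segment p (p + (real r, real_of_int d)) edge_of convex hull lattice_above I w"
  obtains i where "i \<in> I" "i + r \<in> I" "w (i + r) = w i + d"
    "(real i, real_of_int (w i)) extreme_point_of convex hull lattice_above I w"
    "(real (i + r), real_of_int (w (i + r))) extreme_point_of convex hull lattice_above I w"
proof -
  let ?C = "convex hull lattice_above I w" and ?p' = "p + (real r, real_of_int d)"
  have face: "closed_segment p ?p' face_of ?C"
    using assms by (simp add: edge_of_def)
  have ext: "p extreme_point_of ?C" "?p' extreme_point_of ?C"
    using face by (meson extreme_point_of_face extreme_point_of_segment)+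
  obtain i where i: "i \<in> I" "p = (real i, real_of_int (w i))"
    using ext(1) by (rule extreme_point_lattice_above)
  obtain i' where i': "i' \<in> I" "?p' = (real i', real_of_int (w i'))"
    using ext(2) by (rule extreme_point_lattice_above)
  have "i' = i + r" "w i' = w i + d"
    using i i' by (auto simp flip: of_nat_add of_int_add)
  with i i' ext that show ?thesis by auto
qed

text \<open>The line of slope \<open>\<nu>\<close> through the last point supports the hull from
  below and cuts out a face. That this face begins at the leftmost contact \<open>m\<close> is seen
  by turning the line slightly about the point over \<open>m\<close>.\<close>

lemma support_line_edge_lattice_above:
  fixes \<nu> :: real
  assumes "finite I" "n \<in> I" "\<And>i. i \<in> I \<Longrightarrow> i \<le> n"
    and ge: "\<And>i. i \<in> I \<Longrightarrow> w n - \<nu> * (real n - real i) \<le> w i"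
    and m: "m \<in> I" "m < n" "w m = w n - \<nu> * (real n - real m)"
    and m_min: "\<And>i. i \<in> I \<Longrightarrow> w i = w n - \<nu> * (real n - real i) \<Longrightarrow> m \<le> i"
  shows "closed_segment (real m, real_of_int (w m))
           ((real m, real_of_int (w m)) + (real (n - m), real_of_int (w n - w m)))
           edge_of convex hull lattice_above I w"
proof -
  let ?S = "lattice_above I w" and ?b = "w n - \<nu> * n"
  let ?A = "(real m, real_of_int (w m))" and ?B = "(real n, real_of_int (w n))"
  have Bsum: "?A + (real (n - m), real_of_int (w n - w m)) = ?B"
    using m by simp
  \<comment> \<open>\<open>g i\<close> is the largest \<open>\<epsilon>\<close> for which the line
    of slope \<open>\<nu> - \<epsilon>\<close> through the point over \<open>m\<close> does not pass
    above the point over \<open>i\<close>. The 1 keeps the minimum defined when \<open>m\<close> is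
    the leftmost index.\<close>
  define g where "g i = (w i - \<nu> * i - ?b) / (real m - real i)" for i
  define \<epsilon> where "\<epsilon> = Min (insert 1 (g ` {i\<in>I. i < m}))"
  have "0 < g i" if "i \<in> I" "i < m" for i
  proof -
    have "w i \<noteq> w n - \<nu> * (real n - real i)" using m_min that by fastforce
    then have "w i > w n - \<nu> * (real n - real i)" using ge[OF that(1)] by linarith
    then show ?thesis using that by (simp add: g_def field_simps)
  qed
  then have "\<epsilon> > 0" using assms(1) by (auto simp: \<epsilon>_def)
  have eps: "w i - \<nu> * i - ?b \<ge> \<epsilon> * (real m - real i)" if "i \<in> I" for i
  proof (cases "i < m")
    case True
    then have "\<epsilon> \<le> g i" using assms(1) that by (auto simp: \<epsilon>_def)
    then show ?thesis using True by (simp add: g_def field_simps)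
  next
    case False
    then have "\<epsilon> * (real m - real i) \<le> 0"
      using \<open>\<epsilon> > 0\<close> by (simp add: mult_nonneg_nonpos)
    moreover have "w i - \<nu> * i - ?b \<ge> 0" using ge[OF that] assms(3)[OF that]
      by (simp add: algebra_simps)
    ultimately show ?thesis by linarith
  qed
  \<comment> \<open>On the supporting line, the turned line forces the abscissa to be at least
    \<open>m\<close>, and the vertical half-plane bounds it by \<open>n\<close>.\<close>
  have hull: "convex hull ?S \<subseteq> {x. (-\<nu>, 1) \<bullet> x \<ge> ?b} \<inter> {x. (\<epsilon> - \<nu>, 1) \<bullet> x \<ge> ?b + \<epsilon> * m} \<inter> {x. (1, 0) \<bullet> x \<le> real n}"
  proof (rule hull_minimal)
    show "?S \<subseteq> {x. (-\<nu>, 1) \<bullet> x \<ge> ?b} \<inter> {x. (\<epsilon> - \<nu>, 1) \<bullet> x \<ge> ?b + \<epsilon> * m} \<inter> {x. (1, 0) \<bullet> x \<le> real n}"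
    proof
      fix x assume "x \<in> ?S"
      then obtain i j where ij: "i \<in> I" "w i \<le> j" "x = (real i, real_of_int j)"
        by (auto simp: lattice_above_def)
      have "real_of_int j \<ge> w i" using ij by simp
      then show "x \<in> {x. (-\<nu>, 1) \<bullet> x \<ge> ?b} \<inter> {x. (\<epsilon> - \<nu>, 1) \<bullet> x \<ge> ?b + \<epsilon> * m} \<inter> {x. (1, 0) \<bullet> x \<le> real n}"
        using ge[OF ij(1)] eps[OF ij(1)] assms(3)[OF ij(1)] ij
        by (auto simp: inner_prod_def algebra_simps of_nat_diff)
    qed
  qed (intro convex_Int convex_halfspace_ge convex_halfspace_le)
  have face: "(convex hull ?S \<inter> {x. (-\<nu>, 1) \<bullet> x = ?b}) face_of convex hull ?S"
    by (rule face_of_Int_supporting_hyperplane_ge) (use hull in auto)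
  moreover have "convex hull ?S \<inter> {x. (-\<nu>, 1) \<bullet> x = ?b} = closed_segment ?A ?B"
  proof
    show "closed_segment ?A ?B \<subseteq> convex hull ?S \<inter> {x. (-\<nu>, 1) \<bullet> x = ?b}"
    proof (rule closed_segment_subset)
      have "?A \<in> ?S" "?B \<in> ?S" using m(1) assms(2) unfolding lattice_above_def by blast+
      then have "?A \<in> convex hull ?S" "?B \<in> convex hull ?S" by (blast intro: hull_inc)+
      moreover have "?A \<in> {x. (-\<nu>, 1) \<bullet> x = ?b}" "?B \<in> {x. (-\<nu>, 1) \<bullet> x = ?b}"
        using m(3) by (auto simp: inner_prod_def algebra_simps)
      ultimately show "?A \<in> convex hull ?S \<inter> {x. (-\<nu>, 1) \<bullet> x = ?b}" "?B \<in> convex hull ?S \<inter> {x. (-\<nu>, 1) \<bullet> x = ?b}"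
        by blast+
    qed (intro convex_Int convex_convex_hull convex_hyperplane)
    show "convex hull ?S \<inter> {x. (-\<nu>, 1) \<bullet> x = ?b} \<subseteq> closed_segment ?A ?B"
    proof
      fix z assume z: "z \<in> convex hull ?S \<inter> {x. (-\<nu>, 1) \<bullet> x = ?b}"
      obtain x y where xy: "z = (x, y)" by force
      have "(\<epsilon> - \<nu>) * x + y \<ge> ?b + \<epsilon> * m" "x \<le> n" "y - \<nu> * x = ?b"
        using z hull by (auto simp: xy inner_prod_def)
      then have "\<epsilon> * x \<ge> \<epsilon> * m" by (simp add: algebra_simps)
      then have "x \<ge> m" using \<open>\<epsilon> > 0\<close> by simp
      have y: "y = w n - \<nu> * (real n - x)" using \<open>y - \<nu> * x = ?b\<close> by (simp add: algebra_simps)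
      define u where "u = (x - m) / (n - m)"
      have u: "0 \<le> u" "u \<le> 1" using m \<open>x \<ge> m\<close> \<open>x \<le> n\<close> by (auto simp: u_def)
      have um: "u * (real n - real m) = x - m" using m by (simp add: u_def)
      have "x = (1 - u) * m + u * n" using um by (simp add: algebra_simps)
      moreover have "(1 - u) * w m + u * w n = w m + \<nu> * (u * (real n - real m))"
        unfolding m(3) by (simp add: algebra_simps)
      then have "y = (1 - u) * w m + u * w n" unfolding um y m(3) by (simp add: algebra_simps)
      ultimately show "z \<in> closed_segment ?A ?B"
        unfolding in_segment xy using u by (auto intro!: exI[of _ u])
    qed
  qed
  moreover have "aff_dim (closed_segment ?A ?B) = 1"
    using m(2) by (simp add: segment_convex_hull aff_dim_convex_hull aff_dim_2)
  ultimately show ?thesis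
    unfolding Bsum by (simp add: edge_of_def)
qed

text \<open>Edges are given geometrically, so one of maximal slope has to be located. If it ended
  before \<open>n\<close>, convexity would make the chord from its end to the last point steeper;
  but the supporting line through the last point contains an edge at least as steep as every such
  chord.\<close>

lemma largest_slope_lattice_above:
  assumes I: "finite I" "n \<in> I" "\<And>i. i \<in> I \<Longrightarrow> i \<le> n"
    and r: "r > 0"
    and edge: "closed_segment p (p + (real r, real_of_int d)) edge_of convex hull lattice_above I w"
    and max: "\<And>p' r' d'. r' > 0 \<Longrightarrow>
      closed_segment p' (p' + (real r', real_of_int d')) edge_of convex hull lattice_above I w \<Longrightarrow>
      d' / r' \<le> d / r"
  shows "r \<le> n" "n - r \<in> I" "w n - w (n - r) = d"
    and "\<And>i. i \<in> I \<Longrightarrow> w n - (d / r) * (real n - real i) \<le> w i"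
    and "\<And>i. i \<in> I \<Longrightarrow> i < n - r \<Longrightarrow> w n - (d / r) * (real n - real i) < w i"
proof -
  let ?C = "convex hull lattice_above I w"
  obtain k where k: "k \<in> I" "k + r \<in> I" "w (k + r) = w k + d"
    and ext: "(real k, real_of_int (w k)) extreme_point_of ?C"
       "(real (k + r), real_of_int (w (k + r))) extreme_point_of ?C"
    using edge by (rule edge_lattice_above)
  define sl where "sl i = (w n - w i) / (real n - real i)" for i
  \<comment> \<open>The least slope for which the line through the point over \<open>n\<close>
    passes above none of the others.\<close>
  define \<nu> where "\<nu> = Max (sl ` (I - {n}))"
  have "k < n" using I(3)[OF k(2)] r by simp
  then have "k \<in> I - {n}" using k by auto
  then have ne: "sl ` (I - {n}) \<noteq> {}" by blast
  have fin: "finite (sl ` (I - {n}))" using I by simp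
  have ge: "w n - \<nu> * (real n - real i) \<le> w i" if "i \<in> I" for i
  proof (cases "i = n")
    case False
    then have "sl i \<le> \<nu>" using that fin by (auto simp: \<nu>_def)
    moreover have "i < n" using I(3)[OF that] False by simp
    ultimately show ?thesis by (simp add: sl_def field_simps)
  qed simp
  define M where "M = {i\<in>I. i < n \<and> w i = w n - \<nu> * (real n - real i)}"
  obtain m0 where m0: "m0 \<in> I - {n}" "sl m0 = \<nu>"
    using Max_in[OF fin ne] unfolding \<nu>_def by (metis imageE)
  then have "m0 < n" using I(3)[of m0] by auto
  then have "m0 \<in> M" using m0 by (auto simp: M_def sl_def field_simps)
  moreover have "finite M" using I by (simp add: M_def)
  ultimately have mM: "Min M \<in> M" by (intro Min_in) auto
  define m where "m = Min M"
  have m: "m \<in> I" "m < n" "w m = w n - \<nu> * (real n - real m)"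
    using mM by (auto simp: m_def M_def)
  have m_min: "m \<le> i" if "i \<in> I" "w i = w n - \<nu> * (real n - real i)" for i
  proof (cases "i = n")
    case False
    then have "i \<in> M" using that I(3)[of i] by (auto simp: M_def)
    then show ?thesis using \<open>finite M\<close> by (simp add: m_def)
  qed (use m in simp)
  have "real_of_int (w n - w m) / real (n - m) \<le> d / r"
    by (rule max[OF _ support_line_edge_lattice_above[OF I ge m m_min]]) (use m in auto)
  moreover have "real_of_int (w n - w m) / real (n - m) = \<nu>"
    using m by (simp add: of_nat_diff)
  ultimately have nu_le: "\<nu> \<le> d / r" by simp
  have inC: "(real i, real_of_int j) \<in> ?C" if "i \<in> I" "w i \<le> j" for i j
    using that by (auto simp: lattice_above_def intro!: hull_inc)
  have inC1: "(real i, real_of_int (w i) + 1) \<in> ?C" if "i \<in> I" for i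
    using inC[OF that, of "w i + 1"] by simp
  \<comment> \<open>By strict convexity at the right end of the edge, the chord from there to the
    last point would be steeper than \<open>d / r\<close>, whereas no chord to the last point is
    steeper than \<open>\<nu>\<close>.\<close>
  have kr: "k + r = n"
  proof (rule ccontr)
    assume "k + r \<noteq> n"
    then have krn: "k + r < n" using I(3)[OF k(2)] by simp
    have "w (k + r) * (real n - real k) < w k * (real n - real (k + r)) + w n * (real (k + r) - real k)"
      using extreme_point_below_chord[OF _ ext(2) inC1 inC inC, OF _ k(2) k(1) _ I(2)] krn r by simp
    then have "d * (real n - real k - r) < real_of_int (w n - w (k + r)) * r"
      using k(3) by (simp add: algebra_simps)
    moreover have "w n - w (k + r) \<le> \<nu> * (real n - real k - r)"
      using ge[OF k(2)] krn by (simp add: of_nat_diff algebra_simps)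
    then have "real_of_int (w n - w (k + r)) * r \<le> \<nu> * (real n - real k - r) * r"
      by (rule mult_right_mono) simp
    moreover have "\<nu> * r \<le> d" using nu_le r by (simp add: field_simps)
    then have "\<nu> * r * (real n - real k - r) \<le> d * (real n - real k - r)"
      by (rule mult_right_mono) (use krn in linarith)
    ultimately show False by (simp only: ac_simps)
  qed
  have kr': "real n - real k = r" and w_n: "w n = w k + d" using kr k(3) by auto
  have "d / r \<le> \<nu>"
    using ge[OF k(1)] r unfolding kr' w_n by (simp add: field_simps)
  then have nu: "\<nu> = d / r" using nu_le by simp
  have wk: "w k = w n - \<nu> * (real n - real k)"
    using r unfolding kr' w_n nu by simp
  then have "m \<le> k" using m_min k by blast
  \<comment> \<open>Otherwise the left end of the edge would lie strictly between two points of the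
    hull on the supporting line.\<close>
  have "m = k"
  proof (rule ccontr)
    assume "m \<noteq> k"
    then have "m < k" using \<open>m \<le> k\<close> by simp
    have "w k * (real n - real m) < w m * (real n - real k) + w n * (real k - real m)"
      using extreme_point_below_chord[OF _ ext(1) inC1 inC inC, OF _ k(1) m(1) _ I(2)]
        \<open>m < k\<close> \<open>k < n\<close> by simp
    moreover have "\<dots> = w k * (real n - real m)"
      unfolding wk m(3) by (simp add: algebra_simps)
    ultimately show False by simp
  qed
  have nr: "n - r = k" using kr by simp
  show "r \<le> n" "n - r \<in> I" "w n - w (n - r) = d"
    using k kr nr by auto
  show "w n - (d / r) * (real n - real i) \<le> w i" if "i \<in> I" for i
    using ge[OF that] nu by simp
  show "w n - (d / r) * (real n - real i) < w i" if "i \<in> I" "i < n - r" for i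
  proof -
    have "w i \<noteq> w n - \<nu> * (real n - real i)" using m_min[of i] that nr \<open>m = k\<close> by fastforce
    then show ?thesis using ge[OF that(1)] unfolding nu by linarith
  qed
qed

section \<open>Convergence of formal solutions\<close>

lemma fps_conv_radius_posD:
  fixes F :: "complex fps"
  assumes "fps_conv_radius F > 0"
  obtains M \<rho> where "M > 0" "\<rho> > 0" "\<And>n. norm (fps_nth F n) \<le> M * \<rho> ^ n"
proof -
  obtain r where r: "0 < ereal r" "ereal r < fps_conv_radius F"
    using assms ereal_dense2 by blast
  then have r0: "r > 0" by simp
  have "summable (\<lambda>n. fps_nth F n * of_real r ^ n)"
    using r r0 by (intro summable_fps) auto
  then have "Bseq (\<lambda>n. fps_nth F n * of_real r ^ n)"
    by (intro convergent_imp_Bseq convergentI) (rule summable_LIMSEQ_zero)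
  then obtain M where M: "M > 0" "\<And>n. norm (fps_nth F n * of_real r ^ n) \<le> M"
    by (auto simp: Bseq_def)
  have "norm (fps_nth F n) \<le> M * (1 / r) ^ n" for n
    using M(2)[of n] r0 by (simp add: norm_mult norm_power power_divide field_simps)
  with M(1) r0 show ?thesis by (intro that[of M "1 / r"]) auto
qed

lemma fps_conv_radius_posI:
  fixes F :: "complex fps"
  assumes "\<rho> > 0" "\<forall>\<^sub>F n in sequentially. norm (fps_nth F n) \<le> M * \<rho> ^ n"
  shows "fps_conv_radius F > 0"
proof -
  define z :: complex where "z = of_real (1 / (2 * \<rho>))"
  have nz: "norm z = 1 / (2 * \<rho>)" using assms(1) by (simp add: z_def norm_divide norm_mult)
  have "summable (\<lambda>n. fps_nth F n * z ^ n)"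
  proof (rule summable_comparison_test_ev)
    show "\<forall>\<^sub>F n in sequentially. norm (fps_nth F n * z ^ n) \<le> M * (1 / 2) ^ n"
      using assms(2)
    proof eventually_elim
      case (elim n)
      have "norm (fps_nth F n * z ^ n) \<le> M * \<rho> ^ n * (1 / (2 * \<rho>)) ^ n"
        unfolding norm_mult norm_power nz
        by (rule mult_right_mono[OF elim]) (use assms(1) in simp)
      also have "\<dots> = M * (1 / 2) ^ n"
        using assms(1) by (simp add: power_divide power_mult_distrib)
      finally show ?case .
    qed
    show "summable (\<lambda>n. M * (1 / 2) ^ n)"
      by (intro summable_mult summable_geometric) simp
  qed
  then have "conv_radius (fps_nth F) \<ge> norm z" by (rule conv_radius_geI)
  then show ?thesis
    unfolding fps_conv_radius_def using nz assms(1) by (auto intro: less_le_trans[rotated])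
qed

lemma has_fps_expansion_scale:
  fixes f :: "complex \<Rightarrow> complex"
  assumes "f has_fps_expansion F"
  shows "(\<lambda>z. f (c * z)) has_fps_expansion fps_compose F (fps_const c * fps_X)"
proof -
  have "(f \<circ> (\<lambda>z. c * z)) has_fps_expansion fps_compose F (fps_const c * fps_X)"
    by (intro has_fps_expansion_compose assms fps_expansion_intros) simp
  then show ?thesis by (simp add: o_def)
qed

text \<open>The recursion for the coefficients of a formal solution with constant term 1. The kernel
  is not a function of \<open>m - k\<close> alone, because the shifts contribute powers of
  \<open>q\<close>.\<close>

fun linear_rec :: "(nat \<Rightarrow> nat \<Rightarrow> complex) \<Rightarrow> nat \<Rightarrow> complex" where
  "linear_rec K m = (if m = 0 then 1 else \<Sum>k<m. K m k * linear_rec K k)"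

declare linear_rec.simps [simp del]

text \<open>Up to the factor \<open>\<rho> ^ m\<close>, each term is at most \<open>C\<close> times
  the sum of the bounds of its predecessors. The powers of \<open>1 + C\<close> are a majorant,
  since \<open>C\<close> times their sum over k < m telescopes to
  \<open>(1 + C) ^ m - 1\<close>.\<close>

lemma linear_rec_bound:
  assumes "C \<ge> 0" "\<rho> > 0" "\<And>m k. k < m \<Longrightarrow> norm (K m k) \<le> C * \<rho> ^ (m - k)"
  shows "norm (linear_rec K m) \<le> (\<rho> * (1 + C)) ^ m"
proof (induction m rule: less_induct)
  case (less m)
  show ?case
  proof (cases "m = 0")
    case False
    have "norm (linear_rec K m) \<le> (\<Sum>k<m. norm (K m k * linear_rec K k))"
      using False by (subst linear_rec.simps) (auto intro: norm_sum)
    also have "\<dots> \<le> (\<Sum>k<m. \<rho> ^ m * (C * (1 + C) ^ k))"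
    proof (rule sum_mono)
      fix k assume k: "k \<in> {..<m}"
      have "norm (K m k * linear_rec K k) \<le> (C * \<rho> ^ (m - k)) * (\<rho> * (1 + C)) ^ k"
        unfolding norm_mult using assms k less[of k] by (intro mult_mono) auto
      also have "\<dots> = (\<rho> ^ (m - k) * \<rho> ^ k) * (C * (1 + C) ^ k)"
        by (simp add: power_mult_distrib)
      also have "\<rho> ^ (m - k) * \<rho> ^ k = \<rho> ^ m"
        using k by (simp flip: power_add)
      finally show "norm (K m k * linear_rec K k) \<le> \<rho> ^ m * (C * (1 + C) ^ k)" .
    qed
    also have "\<dots> = \<rho> ^ m * (C * (\<Sum>k<m. (1 + C) ^ k))"
      by (simp add: sum_distrib_left)
    also have "C * (\<Sum>k<m. (1 + C) ^ k) = (1 + C) ^ m - 1"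
      using power_diff_1_eq[of "1 + C" m] by simp
    also have "\<rho> ^ m * ((1 + C) ^ m - 1) \<le> (\<rho> * (1 + C)) ^ m"
      using assms unfolding power_mult_distrib by (intro mult_left_mono) auto
    finally show ?thesis .
  qed (simp add: linear_rec.simps)
qed

lemma positive_seq_lower_bound:
  fixes f :: "nat \<Rightarrow> real"
  assumes "f \<longlonglongrightarrow> L" "L > 0" "\<And>m. m \<ge> 1 \<Longrightarrow> f m > 0"
  obtains \<delta> where "\<delta> > 0" "\<And>m. m \<ge> 1 \<Longrightarrow> f m \<ge> \<delta>"
proof -
  have "\<forall>\<^sub>F m in sequentially. f m > L / 2"
    using assms by (intro order_tendstoD(1)) auto
  then obtain N where N: "\<And>m. m \<ge> N \<Longrightarrow> f m > L / 2"
    by (auto simp: eventually_sequentially)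
  define \<delta> where "\<delta> = Min (insert (L / 2) (f ` {1..N}))"
  have "\<delta> > 0" using assms by (auto simp: \<delta>_def)
  moreover have "f m \<ge> \<delta>" if "m \<ge> 1" for m
  proof (cases "m \<le> N")
    case True
    then show ?thesis unfolding \<delta>_def using that by (intro Min_le) auto
  next
    case False
    have "\<delta> \<le> L / 2" unfolding \<delta>_def by (intro Min_le) auto
    then show ?thesis using N[of m] False by simp
  qed
  ultimately show ?thesis using that by blast
qed

text \<open>
  The coefficient of \<open>z ^ m\<close> in the equation reads \<open>\<phi> m * h m = - (\<Sum>k<m. \<dots> * h k)\<close>, where \<open>\<phi> m\<close> grows
  like \<open>q ^ (m * n)\<close> because \<open>b n\<close> does not vanish at 0; this outweighs the factors \<open>q ^ (i * k)\<close>
  on the right, so that the formal solution converges.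
\<close>

lemma adams_convergent_solution:
  fixes b :: "nat \<Rightarrow> complex \<Rightarrow> complex"
  assumes q: "norm q > 1"
    and an: "\<And>i. i \<le> n \<Longrightarrow> b i analytic_on {0}"
    and lead: "b n 0 \<noteq> 0"
    and root: "(\<Sum>i\<le>n. b i 0) = 0"
    and nonres: "\<And>m. m \<ge> 1 \<Longrightarrow> (\<Sum>i\<le>n. b i 0 * (q ^ m) ^ i) \<noteq> 0"
  obtains h where "h analytic_on {0}" "h 0 = 1"
    "\<forall>\<^sub>F z in nhds 0. (\<Sum>i\<le>n. b i z * h (q ^ i * z)) = 0"
proof -
  have q0: "q \<noteq> 0" using q by auto
  define B where "B i = fps_expansion (b i) 0" for i
  have B: "b i has_fps_expansion B i" if "i \<le> n" for i
    unfolding B_def by (rule analytic_at_imp_has_fps_expansion_0[OF an[OF that]])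
  have B0: "fps_nth (B i) 0 = b i 0" if "i \<le> n" for i
    using fps_nth_fps_expansion[OF B[OF that], of 0] by simp
  define \<phi> where "\<phi> m = (\<Sum>i\<le>n. b i 0 * (q ^ m) ^ i)" for m
  \<comment> \<open>The factor with which the coefficient of z^k of \<open>h\<close> enters the
    coefficient of z^m of the equation; on the diagonal it is \<open>\<phi> m\<close>.\<close>
  define T where "T m k = (\<Sum>i\<le>n. fps_nth (B i) (m - k) * (q ^ i) ^ k)" for m k
  define K where "K m k = - T m k / \<phi> m" for m k
  define H where "H = Abs_fps (linear_rec K)"
  have T_diag: "T m m = \<phi> m" for m
    unfolding T_def \<phi>_def by (intro sum.cong) (auto simp: B0 mult.commute simp flip: power_mult)
  have "(\<Sum>i\<le>n. fps_compose H (fps_const (q ^ i) * fps_X) * B i) = 0"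
  proof (rule fps_ext)
    fix m
    have "fps_nth (\<Sum>i\<le>n. fps_compose H (fps_const (q ^ i) * fps_X) * B i) m =
        (\<Sum>i\<le>n. \<Sum>k=0..m. (q ^ i) ^ k * linear_rec K k * fps_nth (B i) (m - k))"
      by (simp add: fps_sum_nth fps_mult_nth H_def)
    also have "\<dots> = (\<Sum>k=0..m. \<Sum>i\<le>n. (q ^ i) ^ k * linear_rec K k * fps_nth (B i) (m - k))"
      by (rule sum.swap)
    also have "\<dots> = (\<Sum>k=0..m. T m k * linear_rec K k)"
      unfolding T_def sum_distrib_right by (simp add: ac_simps)
    also have "{0..m} = insert m {..<m}" by auto
    also have "(\<Sum>k\<in>insert m {..<m}. T m k * linear_rec K k) =
        \<phi> m * linear_rec K m + (\<Sum>k<m. T m k * linear_rec K k)"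
      by (simp add: T_diag)
    also have "\<dots> = 0"
    proof (cases "m = 0")
      case False
      then have "\<phi> m \<noteq> 0" using nonres[of m] by (simp add: \<phi>_def)
      then have "\<phi> m * linear_rec K m = (\<Sum>k<m. - T m k * linear_rec K k)"
        using False by (subst linear_rec.simps) (simp add: K_def sum_distrib_left)
      then show ?thesis by (simp add: sum_negf)
    qed (use root in \<open>simp add: \<phi>_def\<close>)
    finally show "fps_nth (\<Sum>i\<le>n. fps_compose H (fps_const (q ^ i) * fps_X) * B i) m = fps_nth 0 m"
      by simp
  qed
  moreover have "fps_conv_radius H > 0"
  proof -
    have "\<exists>M \<rho>. M > 0 \<and> \<rho> > 0 \<and> (\<forall>k. norm (fps_nth (B i) k) \<le> M * \<rho> ^ k)" if "i \<le> n" for i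
      using B[OF that] unfolding has_fps_expansion_def by (meson fps_conv_radius_posD)
    then obtain M' \<rho>' where M': "\<And>i. i \<le> n \<Longrightarrow> M' i > 0 \<and> \<rho>' i > 0 \<and>
        (\<forall>k. norm (fps_nth (B i) k) \<le> M' i * \<rho>' i ^ k)"
      by metis
    define M where "M = Max (M' ` {..n})"
    define \<rho> where "\<rho> = Max (\<rho>' ` {..n})"
    have M: "M' i \<le> M" and \<rho>: "\<rho>' i \<le> \<rho>" if "i \<le> n" for i
      unfolding M_def \<rho>_def using that by (auto intro!: Max_ge)
    have M0: "M > 0" and \<rho>0: "\<rho> > 0" using M[of n] \<rho>[of n] M'[of n] by auto
    have Bbound: "norm (fps_nth (B i) k) \<le> M * \<rho> ^ k" if "i \<le> n" for i k
    proof -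
      have "norm (fps_nth (B i) k) \<le> M' i * \<rho>' i ^ k" using M' that by blast
      also have "\<dots> \<le> M * \<rho> ^ k"
        using M[OF that] \<rho>[OF that] M'[OF that] by (intro mult_mono power_mono) auto
      finally show ?thesis .
    qed
    \<comment> \<open>After this normalisation only the term \<open>i = n\<close> survives in the
      limit, which is \<open>norm (b n 0)\<close>. Nonresonance gives positivity at the small
      indices too, whence a uniform lower bound.\<close>
    define c where "c m = norm (\<phi> m) / norm (q ^ m) ^ n" for m
    have "(\<lambda>m. \<Sum>i\<le>n. b i 0 * (q ^ i / q ^ n) ^ m) \<longlonglongrightarrow> (\<Sum>i\<le>n. if i = n then b n 0 else 0)"
    proof (intro tendsto_sum)
      fix i assume i: "i \<in> {..n}"
      show "(\<lambda>m. b i 0 * (q ^ i / q ^ n) ^ m) \<longlonglongrightarrow> (if i = n then b n 0 else 0)"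
      proof (cases "i = n")
        case False
        then have "norm (q ^ i / q ^ n) < 1"
          using i q by (auto simp: norm_divide norm_power divide_less_eq)
        then show ?thesis using False by (auto intro!: tendsto_mult_right_zero LIMSEQ_power_zero)
      qed (use q in auto)
    qed
    then have "(\<lambda>m. norm (\<Sum>i\<le>n. b i 0 * (q ^ i / q ^ n) ^ m)) \<longlonglongrightarrow> norm (b n 0)"
      using tendsto_norm by fastforce
    moreover have "norm (\<Sum>i\<le>n. b i 0 * (q ^ i / q ^ n) ^ m) = c m" for m
      unfolding c_def \<phi>_def
      by (simp add: sum_divide_distrib power_divide mult.commute flip: power_mult norm_power norm_divide)
    ultimately have "c \<longlonglongrightarrow> norm (b n 0)" by simp
    moreover have "c m > 0" if "m \<ge> 1" for m
      unfolding c_def using nonres[OF that] q0 by (intro divide_pos_pos) (auto simp: \<phi>_def)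
    ultimately obtain \<delta> where \<delta>: "\<delta> > 0" "\<And>m. m \<ge> 1 \<Longrightarrow> c m \<ge> \<delta>"
      using positive_seq_lower_bound[of c "norm (b n 0)"] lead by auto
    have Kbound: "norm (K m k) \<le> real (Suc n) * M / \<delta> * \<rho> ^ (m - k)" if "k < m" for m k
    proof -
      have "norm (T m k) \<le> (\<Sum>i\<le>n. M * \<rho> ^ (m - k) * norm (q ^ m) ^ n)"
        unfolding T_def
      proof (rule order_trans[OF norm_sum sum_mono])
        fix i assume i: "i \<in> {..n}"
        have "norm ((q ^ i) ^ k) \<le> norm (q ^ m) ^ n"
          unfolding norm_power power_mult[symmetric]
          using i that q mult_mono[of i n k m] by (intro power_increasing) (auto simp: mult.commute[of m])
        then show "norm (fps_nth (B i) (m - k) * (q ^ i) ^ k) \<le> M * \<rho> ^ (m - k) * norm (q ^ m) ^ n"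
          unfolding norm_mult using Bbound[of i] i M0 \<rho>0 by (intro mult_mono) auto
      qed
      moreover have "norm (\<phi> m) \<ge> \<delta> * norm (q ^ m) ^ n"
        using \<delta>(2)[of m] that q0 by (simp add: c_def pos_le_divide_eq)
      ultimately have "norm (K m k) \<le> (real (Suc n) * (M * \<rho> ^ (m - k) * norm (q ^ m) ^ n)) / (\<delta> * norm (q ^ m) ^ n)"
        unfolding K_def norm_divide norm_minus_cancel using \<delta>(1) q0 M0 \<rho>0
        by (intro frac_le) auto
      also have "\<dots> = real (Suc n) * M / \<delta> * \<rho> ^ (m - k)" using q0 by simp
      finally show ?thesis .
    qed
    have "norm (fps_nth H m) \<le> 1 * (\<rho> * (1 + real (Suc n) * M / \<delta>)) ^ m" for m
      unfolding H_def using linear_rec_bound[OF _ \<rho>0 Kbound] M0 \<delta>(1) by simp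
    moreover have "\<rho> * (1 + real (Suc n) * M / \<delta>) > 0"
      using \<rho>0 M0 \<delta>(1) by (intro mult_pos_pos add_pos_nonneg) auto
    ultimately show ?thesis
      by (intro fps_conv_radius_posI[of "\<rho> * (1 + real (Suc n) * M / \<delta>)" H 1]) auto
  qed
  then have "eval_fps H has_fps_expansion H" by (rule eval_fps_has_fps_expansion)
  moreover from this have "(\<lambda>z. \<Sum>i\<le>n. eval_fps H (q ^ i * z) * b i z) has_fps_expansion
      (\<Sum>i\<le>n. fps_compose H (fps_const (q ^ i) * fps_X) * B i)"
    by (intro has_fps_expansion_sum has_fps_expansion_mult has_fps_expansion_scale B) auto
  ultimately have "\<forall>\<^sub>F z in nhds 0. (\<Sum>i\<le>n. eval_fps H (q ^ i * z) * b i z) = 0"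
    "eval_fps H analytic_on {0}"
    by (auto simp: has_fps_expansion_0_iff intro: has_fps_expansion_imp_analytic_0)
  moreover have "eval_fps H 0 = 1" by (simp add: eval_fps_at_0 H_def linear_rec.simps)
  ultimately show ?thesis by (intro that[of "eval_fps H"]) (simp_all add: mult.commute)
qed

text \<open>On coefficients the equation multiplies the k-th one of \<open>y\<close> by
  \<open>\<gamma> * q ^ k - 1\<close>. This factor vanishes for at most one k, whose term is left
  over as \<open>s * z ^ m\<close>. It tends to infinity with k, so \<open>y\<close> inherits
  convergence from \<open>w\<close>.\<close>

lemma first_order_analytic:
  fixes w :: "complex \<Rightarrow> complex"
  assumes q: "norm q > 1" and "\<gamma> \<noteq> 0" and w: "w analytic_on {0}"
  obtains y s and m :: nat where "y analytic_on {0}"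
    "\<forall>\<^sub>F z in nhds 0. \<gamma> * y (q * z) - y z = w z - s * z ^ m" "s \<noteq> 0 \<Longrightarrow> \<gamma> * q ^ m = 1"
proof -
  define W where "W = fps_expansion w 0"
  have W: "w has_fps_expansion W"
    unfolding W_def by (rule analytic_at_imp_has_fps_expansion_0[OF w])
  define Y where "Y = Abs_fps (\<lambda>k. if \<gamma> * q ^ k = 1 then 0 else fps_nth W k / (\<gamma> * q ^ k - 1))"
  \<comment> \<open>If no exponent is resonant, this choice is arbitrary and \<open>s\<close> is
    0.\<close>
  define m where "m = (SOME m. \<gamma> * q ^ m = 1)"
  define s where "s = (if \<gamma> * q ^ m = 1 then fps_nth W m else 0)"
  have uniq: "k = m" if "\<gamma> * q ^ k = 1" for k
  proof -
    have "\<gamma> * q ^ m = 1" unfolding m_def using that by (rule someI)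
    with that have "q ^ k = q ^ m" using \<open>\<gamma> \<noteq> 0\<close> by (metis mult_left_cancel)
    then have "norm q ^ k = norm q ^ m" by (metis norm_power)
    then show ?thesis using q by simp
  qed
  have eq: "fps_const \<gamma> * fps_compose Y (fps_const q * fps_X) - Y = W - fps_const s * fps_X ^ m"
  proof (rule fps_ext)
    fix k
    show "fps_nth (fps_const \<gamma> * fps_compose Y (fps_const q * fps_X) - Y) k =
      fps_nth (W - fps_const s * fps_X ^ m) k"
    proof (cases "\<gamma> * q ^ k = 1")
      case True
      then show ?thesis using uniq[OF True] by (simp add: Y_def s_def)
    next
      case False
      then have "s = 0 \<or> k \<noteq> m" by (auto simp: s_def)
      moreover have "\<gamma> * q ^ k * fps_nth Y k - fps_nth Y k = fps_nth W k"
      proof -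
        have "\<gamma> * q ^ k * fps_nth Y k - fps_nth Y k = (\<gamma> * q ^ k - 1) * fps_nth Y k"
          by (simp add: algebra_simps)
        then show ?thesis using False by (simp add: Y_def)
      qed
      ultimately show ?thesis by (auto simp: fps_X_power_iff mult.assoc)
    qed
  qed
  have rad: "fps_conv_radius Y > 0"
  proof -
    obtain M \<rho> where M: "M > 0" "\<rho> > 0" "\<And>n. norm (fps_nth W n) \<le> M * \<rho> ^ n"
      using W unfolding has_fps_expansion_def by (meson fps_conv_radius_posD)
    have "filterlim (\<lambda>k. norm (\<gamma> * q ^ k)) at_top sequentially"
      using q \<open>\<gamma> \<noteq> 0\<close>
      by (intro filterlim_at_infinity_imp_norm_at_top tendsto_mult_filterlim_at_infinity[OF tendsto_const]
          filterlim_realpow_sequentially_gt1)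
    then have "\<forall>\<^sub>F k in sequentially. norm (\<gamma> * q ^ k) \<ge> 2"
      by (simp add: filterlim_at_top)
    then have "\<forall>\<^sub>F k in sequentially. norm (fps_nth Y k) \<le> M * \<rho> ^ k"
    proof eventually_elim
      case (elim k)
      have ge1: "norm (\<gamma> * q ^ k - 1) \<ge> 1"
        using norm_triangle_ineq2[of "\<gamma> * q ^ k" 1] elim by simp
      then have "norm (fps_nth Y k) \<le> norm (fps_nth W k)"
        using divide_left_mono[OF ge1, of "norm (fps_nth W k)"] by (auto simp: Y_def norm_divide)
      with M(3)[of k] show ?case by simp
    qed
    then show ?thesis by (rule fps_conv_radius_posI[OF M(2)])
  qed
  then have Y: "eval_fps Y has_fps_expansion Y" by (rule eval_fps_has_fps_expansion)
  have "(\<lambda>z. (\<gamma> * eval_fps Y (q * z) - eval_fps Y z) - (w z - s * z ^ m)) has_fps_expansion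
     (fps_const \<gamma> * fps_compose Y (fps_const q * fps_X) - Y) - (W - fps_const s * fps_X ^ m)"
    by (intro fps_expansion_intros has_fps_expansion_scale Y W)
  then have "\<forall>\<^sub>F z in nhds 0. (\<gamma> * eval_fps Y (q * z) - eval_fps Y z) - (w z - s * z ^ m) = 0"
    unfolding eq by (simp add: has_fps_expansion_0_iff)
  then have "\<forall>\<^sub>F z in nhds 0. \<gamma> * eval_fps Y (q * z) - eval_fps Y z = w z - s * z ^ m"
    by (simp only: right_minus_eq)
  moreover have "\<gamma> * q ^ m = 1" if "s \<noteq> 0" using that by (metis s_def)
  ultimately show ?thesis
    using that has_fps_expansion_imp_analytic_0[OF Y] by blast
qed

text \<open>Splitting off \<open>z powi N\<close> from \<open>w\<close> and \<open>y\<close> turns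
  \<open>\<gamma>\<close> into \<open>\<gamma> * q powi N\<close> and reduces to the analytic case;
  the resonant exponent shifts by \<open>N\<close>.\<close>

lemma first_order_meromorphic:
  fixes w :: "complex \<Rightarrow> complex"
  assumes q: "norm q > 1" and "\<gamma> \<noteq> 0" and w: "w meromorphic_on {0}"
  obtains y s and m :: int where "y meromorphic_on {0}"
    "\<forall>\<^sub>F z in at 0. \<gamma> * y (q * z) - y z = w z - s * z powi m" "s \<noteq> 0 \<Longrightarrow> \<gamma> * q powi m = 1"
proof -
  have q0: "q \<noteq> 0" using q by auto
  obtain F where F: "w has_laurent_expansion F"
    using w unfolding meromorphic_on_def by auto
  define N where "N = fls_subdegree F"
  define G where "G = fls_base_factor_to_fps F"
  have G: "eval_fps G analytic_on {0}"
    using eval_fps_has_fps_expansion has_fps_expansion_fls_base_factor_to_fps[OF F]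
    unfolding G_def has_fps_expansion_def[of _ "fls_base_factor_to_fps F"]
    by (intro has_fps_expansion_imp_analytic_0[OF eval_fps_has_fps_expansion]) blast
  have wG: "\<forall>\<^sub>F z in at 0. w z = eval_fps G z * z powi N"
    using F unfolding has_laurent_expansion_def eval_fls_def G_def N_def by (auto elim!: eventually_mono)
  have nz: "\<gamma> * q powi N \<noteq> 0" using \<open>\<gamma> \<noteq> 0\<close> q0 by simp
  obtain y s and m :: nat where y: "y analytic_on {0}"
    "\<forall>\<^sub>F z in nhds 0. (\<gamma> * q powi N) * y (q * z) - y z = eval_fps G z - s * z ^ m"
    "s \<noteq> 0 \<Longrightarrow> (\<gamma> * q powi N) * q ^ m = 1"
    by (rule first_order_analytic[OF q nz G]) blast
  have "(\<lambda>z. z powi N * y z) meromorphic_on {0}"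
    using y(1) by (intro meromorphic_intros analytic_on_imp_meromorphic_on)
  moreover have "\<forall>\<^sub>F z in at 0. \<gamma> * ((q * z) powi N * y (q * z)) - z powi N * y z =
      w z - s * z powi (N + int m)"
    using wG filter_leD[OF at_within_le_nhds y(2)] eventually_neq_at_within[of 0 0]
  proof eventually_elim
    case (elim z)
    have "\<gamma> * ((q * z) powi N * y (q * z)) - z powi N * y z =
       z powi N * ((\<gamma> * q powi N) * y (q * z) - y z)"
      unfolding power_int_mult_distrib right_diff_distrib by (simp only: mult_ac)
    also have "\<dots> = w z - s * z powi (N + int m)"
      unfolding elim(2) elim(1) using elim(3) by (simp add: power_int_add right_diff_distrib)
    finally show ?case .
  qed
  moreover have "\<gamma> * q powi (N + int m) = 1" if "s \<noteq> 0"
    using y(3)[OF that] q0 by (simp add: power_int_add mult.assoc)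
  ultimately show ?thesis using that by blast
qed

section \<open>Germs at 0 of functions on punctured neighbourhoods\<close>

text \<open>
  Two functions are the same germ of \<open>\<M>(\<complex>\<^sup>*, 0)\<close> iff they agree eventually w.r.t. this filter, see
  \<open>eventually_punctured_germ\<close>; unlike \<open>at 0\<close>, it tolerates exceptional points accumulating at 0.
\<close>

definition punctured_germ :: "complex filter" where
  "punctured_germ = (INF e\<in>{0<..}. cosparse (ball 0 e - {0}))"

text \<open>The punctured discs are nested, and being cosparse in an open set is a local condition
  at its points; so the filter is a nested pair of ordinary limits.\<close>

lemma eventually_punctured_germ:
  "eventually P punctured_germ \<longleftrightarrow> (\<forall>\<^sub>F x in at 0. eventually P (at x))"
proof -
  have mono: "cosparse (ball (0::complex) a - {0}) \<le> cosparse (ball 0 b - {0})" if "a \<le> b" for a b :: real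
    unfolding le_filter_def using that by (auto simp: eventually_cosparse_open_eq open_delete)
  have "eventually P punctured_germ \<longleftrightarrow> (\<exists>e\<in>{0<..}. eventually P (cosparse (ball 0 e - {0})))"
    unfolding punctured_germ_def
  proof (rule eventually_INF_base)
    fix a b :: real assume "a \<in> {0<..}" "b \<in> {0<..}"
    then show "\<exists>x\<in>{0<..}. cosparse (ball (0::complex) x - {0}) \<le>
        inf (cosparse (ball 0 a - {0})) (cosparse (ball 0 b - {0}))"
      by (intro bexI[of _ "min a b"]) (auto intro!: mono)
  qed auto
  also have "\<dots> \<longleftrightarrow> (\<exists>e\<in>{0<..}. \<forall>x. x \<noteq> 0 \<and> dist x 0 < e \<longrightarrow> eventually P (at x))"
    by (intro bex_cong refl) (auto simp: eventually_cosparse_open_eq open_delete)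
  also have "\<dots> \<longleftrightarrow> (\<forall>\<^sub>F x in at 0. eventually P (at x))"
    by (auto simp: eventually_at[of _ 0])
  finally show ?thesis .
qed

lemma eventually_cosparse_imp_punctured_germ:
  assumes "eventually P (cosparse (U - {0}))" "open U" "0 \<in> U"
  shows "eventually P punctured_germ"
proof -
  have "\<forall>\<^sub>F x in at 0. x \<in> U - {0}"
    using assms(2,3) by (rule eventually_at_in_open)
  then show ?thesis
    unfolding eventually_punctured_germ
    by eventually_elim (use assms(1,2) in \<open>auto simp: eventually_cosparse_open_eq open_delete\<close>)
qed

lemma eventually_at_0_imp_punctured_germ:
  assumes "eventually P (at 0)"
  shows "eventually P punctured_germ"
proof -
  obtain e where e: "e > 0" "\<And>z. z \<noteq> 0 \<Longrightarrow> dist z 0 < e \<Longrightarrow> P z"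
    using assms unfolding eventually_at by auto
  have op: "open (ball 0 e - {0})" by (intro open_delete) auto
  have "eventually P (cosparse (ball 0 e - {0}))"
    unfolding eventually_cosparse_open_eq[OF op]
  proof
    fix x :: complex assume "x \<in> ball 0 e - {0}"
    from eventually_at_in_open'[OF op this] show "eventually P (at x)"
      by eventually_elim (auto intro: e)
  qed
  then show ?thesis
    using e(1) by (intro eventually_cosparse_imp_punctured_germ) auto
qed

lemma eventually_neq_0_punctured_germ: "\<forall>\<^sub>F z in punctured_germ. z \<noteq> 0"
  by (intro eventually_at_0_imp_punctured_germ eventually_neq_at_within)

lemma punctured_germ_neq_bot: "punctured_germ \<noteq> bot"
  unfolding trivial_limit_def eventually_punctured_germ by simp

lemma filterlim_scale_at:
  fixes c :: complex
  assumes "c \<noteq> 0"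
  shows "filterlim (\<lambda>z. c * z) (at (c * x)) (at x)"
  unfolding filterlim_at using assms
  by (auto intro!: tendsto_intros eventually_mono[OF eventually_neq_at_within[of x x]])

lemma eventually_at_scale:
  fixes c :: complex
  assumes "c \<noteq> 0" "eventually P (at (c * x))"
  shows "\<forall>\<^sub>F z in at x. P (c * z)"
  using assms(2) filterlim_scale_at[OF assms(1)] unfolding filterlim_iff by blast

lemma eventually_punctured_germ_scale:
  assumes "c \<noteq> 0" "eventually P punctured_germ"
  shows "\<forall>\<^sub>F z in punctured_germ. P (c * z)"
proof -
  have "\<forall>\<^sub>F x in at 0. eventually P (at (c * x))"
    using eventually_at_scale[OF assms(1), of "\<lambda>x. eventually P (at x)" 0] assms(2)
    by (simp add: eventually_punctured_germ)
  then show ?thesis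
    unfolding eventually_punctured_germ
    by eventually_elim (rule eventually_at_scale[OF assms(1)])
qed

text \<open>In this pointwise form closure properties follow by combining \<open>eventually\<close>
  facts; \<open>mero_germ_alt\<close> recovers a punctured disc.\<close>

definition mero_germ :: "(complex \<Rightarrow> complex) \<Rightarrow> bool" where
  "mero_germ f \<longleftrightarrow> (\<forall>\<^sub>F x in at 0. f meromorphic_on {x})"

lemma mero_germ_alt:
  "mero_germ f \<longleftrightarrow> (\<exists>e>0. f meromorphic_on (ball 0 e - {0}))"
proof -
  have "f meromorphic_on (ball 0 e - {0}) \<longleftrightarrow> (\<forall>x. x \<noteq> 0 \<and> dist x 0 < e \<longrightarrow> f meromorphic_on {x})" for e
    using meromorphic_on_meromorphic_at[of f "ball 0 e - {0}"] by auto
  then show ?thesis unfolding mero_germ_def eventually_at by auto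
qed

lemma meromorphic_on_imp_mero_germ:
  assumes "f meromorphic_on (U - {0})" "open U" "0 \<in> U"
  shows "mero_germ f"
proof -
  have "\<forall>\<^sub>F x in at 0. x \<in> U - {0}" using assms(2,3) by (rule eventually_at_in_open)
  then show ?thesis
    unfolding mero_germ_def
    by eventually_elim (use assms(1) in \<open>auto intro: meromorphic_on_subset\<close>)
qed

lemma meromorphic_at_0_imp_mero_germ:
  assumes "f meromorphic_on {0}"
  shows "mero_germ f"
proof -
  obtain B where "open B" "{0} \<subseteq> B" "f meromorphic_on B"
    using assms by (rule meromorphic_on_open_nhd)
  then show ?thesis
    by (intro meromorphic_on_imp_mero_germ[of _ B]) (auto intro: meromorphic_on_subset)
qed

lemma meromorphic_on_scale:
  assumes "f meromorphic_on {c * x}"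
  shows "(\<lambda>z. f (c * z)) meromorphic_on {x}"
  using assms by (rule meromorphic_on_compose) (auto intro!: analytic_intros)

lemma mero_germ_scale:
  assumes "c \<noteq> 0" "mero_germ f"
  shows "mero_germ (\<lambda>z. f (c * z))"
proof -
  have "\<forall>\<^sub>F x in at 0. f meromorphic_on {c * x}"
    using eventually_at_scale[OF assms(1), of "\<lambda>x. f meromorphic_on {x}" 0] assms(2)
    by (simp add: mero_germ_def)
  then show ?thesis
    unfolding mero_germ_def by eventually_elim (rule meromorphic_on_scale)
qed

named_theorems mero_germ_intros

lemma mero_germ_const [mero_germ_intros]: "mero_germ (\<lambda>_. c)"
  and mero_germ_id [mero_germ_intros]: "mero_germ (\<lambda>z. z)"
  by (simp_all add: mero_germ_def meromorphic_intros)

lemma mero_germ_unop: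
  assumes "\<And>x. f meromorphic_on {x} \<Longrightarrow> h meromorphic_on {x}" "mero_germ f"
  shows "mero_germ h"
  using assms(2) unfolding mero_germ_def by eventually_elim (rule assms(1))

lemma mero_germ_binop:
  assumes "\<And>x. f meromorphic_on {x} \<Longrightarrow> g meromorphic_on {x} \<Longrightarrow> h meromorphic_on {x}"
    "mero_germ f" "mero_germ g"
  shows "mero_germ h"
  using assms(2,3) unfolding mero_germ_def by eventually_elim (rule assms(1))

lemma mero_germ_add [mero_germ_intros]: "mero_germ f \<Longrightarrow> mero_germ g \<Longrightarrow> mero_germ (\<lambda>z. f z + g z)"
  and mero_germ_diff [mero_germ_intros]: "mero_germ f \<Longrightarrow> mero_germ g \<Longrightarrow> mero_germ (\<lambda>z. f z - g z)"
  and mero_germ_mult [mero_germ_intros]: "mero_germ f \<Longrightarrow> mero_germ g \<Longrightarrow> mero_germ (\<lambda>z. f z * g z)"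
  and mero_germ_divide [mero_germ_intros]: "mero_germ f \<Longrightarrow> mero_germ g \<Longrightarrow> mero_germ (\<lambda>z. f z / g z)"
  by (rule mero_germ_binop; blast intro: meromorphic_intros)+

lemma mero_germ_powi [mero_germ_intros]: "mero_germ f \<Longrightarrow> mero_germ (\<lambda>z. f z powi k)"
  and mero_germ_deriv [mero_germ_intros]: "mero_germ f \<Longrightarrow> mero_germ (deriv f)"
  by (erule mero_germ_unop[rotated]; blast intro: meromorphic_intros)+

lemma mero_germ_prod [mero_germ_intros]:
  "(\<And>i. i \<in> A \<Longrightarrow> mero_germ (f i)) \<Longrightarrow> mero_germ (\<lambda>z. \<Prod>i\<in>A. f i z)"
  by (induction A rule: infinite_finite_induct) (auto intro: mero_germ_intros)

text \<open>The identity theorem on a punctured disc, which is still connected. This dichotomy is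
  what makes the germs a field.\<close>

lemma mero_germ_zero_or_nonzero:
  assumes "mero_germ f"
  shows "(\<forall>\<^sub>F z in punctured_germ. f z = 0) \<or> (\<forall>\<^sub>F z in punctured_germ. f z \<noteq> 0)"
proof -
  obtain e where e: "e > 0" "f meromorphic_on (ball 0 e - {0})"
    using assms by (auto simp: mero_germ_alt)
  have "connected (ball (0::complex) e - {0})"
    by (intro connected_open_delete) auto
  then have "eventually (\<lambda>z. f z = 0) (cosparse (ball 0 e - {0})) \<or>
      eventually (\<lambda>z. f z \<noteq> 0) (cosparse (ball 0 e - {0}))"
    using e by (intro meromorphic_imp_constant_or_avoid) (auto simp: open_delete)
  then show ?thesis
    using e(1) eventually_cosparse_imp_punctured_germ[of _ "ball 0 e"] by auto
qed

lemma mero_punctured_nbhds_iff: "f \<in> mero (punctured nbhds_of_0) \<longleftrightarrow> mero_germ f"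
proof
  assume "f \<in> mero (punctured nbhds_of_0)"
  then show "mero_germ f"
    by (auto simp: mero_def punctured_def nbhds_of_0_def intro: meromorphic_on_imp_mero_germ)
next
  assume "mero_germ f"
  then obtain e where "e > 0" "f meromorphic_on (ball 0 e - {0})"
    by (auto simp: mero_germ_alt)
  then show "f \<in> mero (punctured nbhds_of_0)"
    by (auto simp: mero_def punctured_def nbhds_of_0_def intro!: exI[of _ "ball 0 e"])
qed

lemma mero_eq_punctured_nbhds_iff:
  "mero_eq (punctured nbhds_of_0) f g \<longleftrightarrow> (\<forall>\<^sub>F z in punctured_germ. f z = g z)"
proof
  assume "mero_eq (punctured nbhds_of_0) f g"
  then show "\<forall>\<^sub>F z in punctured_germ. f z = g z"
    by (auto simp: mero_eq_def punctured_def nbhds_of_0_def intro: eventually_cosparse_imp_punctured_germ)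
next
  assume "\<forall>\<^sub>F z in punctured_germ. f z = g z"
  then obtain e where e: "e > 0" "\<And>x. x \<noteq> 0 \<Longrightarrow> dist x 0 < e \<Longrightarrow> \<forall>\<^sub>F z in at x. f z = g z"
    unfolding eventually_punctured_germ eventually_at[of _ 0] by auto
  have "open (ball 0 e - {0::complex})" by (intro open_delete) auto
  then have "\<forall>\<^sub>\<approx>z\<in>ball 0 e - {0}. f z = g z"
    using e(2) by (auto simp: eventually_cosparse_open_eq)
  then show "mero_eq (punctured nbhds_of_0) f g"
    using e(1) by (auto simp: mero_eq_def punctured_def nbhds_of_0_def intro!: exI[of _ "ball 0 e"])
qed

section \<open>Theta functions\<close>

text \<open>Equal to q^(-n(n+1)/2), in a form that exhibits the ratio of consecutive
  coefficients.\<close>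

definition theta_coeff :: "complex \<Rightarrow> nat \<Rightarrow> complex" where
  "theta_coeff q n = (\<Prod>k<n. inverse (q ^ Suc k))"

definition partial_theta :: "complex \<Rightarrow> complex \<Rightarrow> complex" where
  "partial_theta q = eval_fps (Abs_fps (theta_coeff q))"

text \<open>
  The two halves of the Jacobi theta series \<open>\<Sum>n\<in>\<int>. q powi (- n * (n + 1) div 2) * z powi n\<close>.
\<close>

definition theta :: "complex \<Rightarrow> complex \<Rightarrow> complex" where
  "theta q z = partial_theta q z + partial_theta q (1 / z) / z"

text \<open>A single-valued substitute for the power of z with exponent log c / log q: the shift
  multiplies it by \<open>c\<close>.\<close>

definition qchar :: "complex \<Rightarrow> complex \<Rightarrow> complex \<Rightarrow> complex" where
  "qchar q c z = theta q z / theta q (z / c)"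

text \<open>A single-valued substitute for log z / log q: the shift adds 1 to it.\<close>

definition qlog :: "complex \<Rightarrow> complex \<Rightarrow> complex" where
  "qlog q z = z * deriv (theta q) z / theta q z"

context
  fixes q :: complex
  assumes q: "norm q > 1"
begin

lemma q_nonzero: "q \<noteq> 0"
  using q by auto

lemma theta_coeff_Suc: "theta_coeff q (Suc n) = theta_coeff q n / q ^ Suc n"
  by (simp add: theta_coeff_def divide_inverse)

lemma theta_coeff_conv_radius: "fps_conv_radius (Abs_fps (theta_coeff q)) = \<infinity>"
proof -
  have nz: "theta_coeff q n \<noteq> 0" for n
    using q_nonzero by (simp add: theta_coeff_def)
  have "conv_radius (theta_coeff q) = \<infinity>"
  proof (rule conv_radius_ratio_limit_ereal)
    have "norm (theta_coeff q n) / norm (theta_coeff q (Suc n)) = norm (q ^ Suc n)" for n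
      using nz[of n] by (simp add: theta_coeff_Suc norm_divide)
    moreover have "filterlim (\<lambda>n. norm (q ^ Suc n)) at_top sequentially"
      using q filterlim_at_infinity_imp_norm_at_top[OF filterlim_realpow_sequentially_gt1]
      by (intro filterlim_compose[OF _ filterlim_Suc]) auto
    ultimately show "(\<lambda>n. ereal (norm (theta_coeff q n) / norm (theta_coeff q (Suc n)))) \<longlonglongrightarrow> \<infinity>"
      by (simp add: tendsto_PInfty_eq_at_top)
  qed (use nz in auto)
  then show ?thesis by (simp add: fps_conv_radius_def)
qed

lemma partial_theta_holomorphic: "partial_theta q holomorphic_on A"
  unfolding partial_theta_def
  by (intro holomorphic_on_eval_fps) (auto simp: theta_coeff_conv_radius)

lemma partial_theta_0: "partial_theta q 0 = 1"
  by (simp add: partial_theta_def eval_fps_at_0 theta_coeff_def)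

text \<open>Since \<open>theta_coeff q (Suc n) * q ^ Suc n = theta_coeff q n\<close>, scaling the
  variable moves the series by one place.\<close>

lemma partial_theta_scale: "partial_theta q (q * z) = 1 + z * partial_theta q z"
proof -
  have sm: "summable (\<lambda>n. theta_coeff q n * w ^ n)" for w
    using summable_fps[of w "Abs_fps (theta_coeff q)"] by (simp add: theta_coeff_conv_radius)
  have "partial_theta q (q * z) = theta_coeff q 0 * (q * z) ^ 0 + (\<Sum>n. theta_coeff q (Suc n) * (q * z) ^ Suc n)"
    unfolding partial_theta_def eval_fps_def fps_nth_Abs_fps
    using suminf_split_head[OF sm[of "q * z"]] by simp
  also have "(\<lambda>n. theta_coeff q (Suc n) * (q * z) ^ Suc n) = (\<lambda>n. z * (theta_coeff q n * z ^ n))"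
    using q_nonzero by (auto simp: theta_coeff_def fun_eq_iff power_mult_distrib field_simps)
  also have "(\<Sum>n. z * (theta_coeff q n * z ^ n)) = z * partial_theta q z"
    unfolding partial_theta_def eval_fps_def fps_nth_Abs_fps by (rule suminf_mult[OF sm])
  finally show ?thesis by (simp add: theta_coeff_def)
qed

text \<open>Under the shift the half in \<open>z\<close> acquires an extra 1, and by the same rule
  at \<open>1 / (q * z)\<close> the half in \<open>1 / z\<close> loses it.\<close>

lemma theta_scale:
  assumes "z \<noteq> 0"
  shows "theta q (q * z) = z * theta q z"
proof -
  have "partial_theta q (1 / z) = 1 + 1 / (q * z) * partial_theta q (1 / (q * z))"
    using partial_theta_scale[of "1 / (q * z)"] q_nonzero assms by simp
  then show ?thesis
    using assms by (simp add: theta_def partial_theta_scale field_simps)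
qed

lemma theta_holomorphic: "theta q holomorphic_on - {0}"
  unfolding theta_def
  by (intro holomorphic_intros partial_theta_holomorphic
      holomorphic_on_compose_gen[OF _ partial_theta_holomorphic, of _ _ UNIV, unfolded o_def]) auto

lemma theta_analytic: "x \<noteq> 0 \<Longrightarrow> theta q analytic_on {x}"
  using theta_holomorphic by (auto simp: analytic_at intro!: exI[of _ "- {0}"])

text \<open>If the halves cancelled, the entire function \<open>partial_theta q\<close> would equal
  \<open>- partial_theta q (1 / z) / z\<close> and tend to 0 at infinity. By Liouville it would
  vanish, but its value at 0 is 1.\<close>

lemma theta_not_zero: "\<not> (\<forall>z. z \<noteq> 0 \<longrightarrow> theta q z = 0)"
proof
  assume zero: "\<forall>z. z \<noteq> 0 \<longrightarrow> theta q z = 0"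
  have "((\<lambda>z. - (partial_theta q (1 / z) * (1 / z))) \<longlongrightarrow> - (partial_theta q 0 * 0)) at_infinity"
  proof (intro tendsto_minus tendsto_mult)
    have inv: "((\<lambda>z::complex. 1 / z) \<longlongrightarrow> 0) at_infinity"
      using tendsto_inverse_0 unfolding inverse_eq_divide .
    have "isCont (partial_theta q) 0"
      using partial_theta_holomorphic[of UNIV] holomorphic_on_imp_continuous_on continuous_on_eq_continuous_at open_UNIV
      by blast
    then show "((\<lambda>z. partial_theta q (1 / z)) \<longlongrightarrow> partial_theta q 0) at_infinity"
      using inv by (rule isCont_tendsto_compose)
    show "((\<lambda>z::complex. 1 / z) \<longlongrightarrow> 0) at_infinity" by (rule inv)
  qed
  moreover have "\<forall>\<^sub>F z in at_infinity. - (partial_theta q (1 / z) * (1 / z)) = partial_theta q z"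
    using eventually_not_equal_at_infinity[of 0]
  proof eventually_elim
    case (elim z)
    have "partial_theta q z + partial_theta q (1 / z) * (1 / z) = 0"
      using zero elim by (simp add: theta_def)
    then show ?case by (metis add_eq_0_iff2)
  qed
  ultimately have "(partial_theta q \<longlongrightarrow> 0) at_infinity"
    using tendsto_cong by force
  then have "partial_theta q 0 = 0"
    by (intro Liouville_weak_0 partial_theta_holomorphic)
  then show False by (simp add: partial_theta_0)
qed

lemma mero_germ_theta [mero_germ_intros]: "mero_germ (theta q)"
proof -
  have "theta q analytic_on UNIV - {0}"
    using theta_analytic analytic_on_analytic_at by blast
  then show ?thesis
    by (intro meromorphic_on_imp_mero_germ[of _ UNIV] analytic_on_imp_meromorphic_on) auto
qed

text \<open>Vanishing on a small punctured disc would spread through the functional equation to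
  discs larger by the factor \<open>norm q\<close>, and so to the whole punctured plane.\<close>

lemma eventually_theta_nonzero: "\<forall>\<^sub>F z in punctured_germ. theta q z \<noteq> 0"
proof (rule ccontr)
  assume "\<not> ?thesis"
  then have "\<forall>\<^sub>F z in punctured_germ. theta q z = 0"
    using mero_germ_zero_or_nonzero[OF mero_germ_theta] by blast
  then obtain e where e: "e > 0" "\<And>x. x \<noteq> 0 \<Longrightarrow> dist x 0 < e \<Longrightarrow> \<forall>\<^sub>F z in at x. theta q z = 0"
    unfolding eventually_punctured_germ eventually_at[of _ 0] by auto
  have zero: "theta q x = 0" if "x \<noteq> 0" "norm x < norm q ^ k * e" for k x
    using that
  proof (induction k arbitrary: x)
    case 0
    then have "\<forall>\<^sub>F z in at x. theta q z = 0" using e(2)[of x] by simp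
    then have "(theta q \<longlongrightarrow> 0) (at x)" by (rule tendsto_eventually)
    moreover have "(theta q \<longlongrightarrow> theta q x) (at x)"
      using analytic_at_imp_isCont[OF theta_analytic[OF 0(1)]] by (simp add: isCont_def)
    ultimately show ?case using tendsto_unique trivial_limit_at by blast
  next
    case (Suc k)
    have "theta q (x / q) = 0"
      using Suc.prems q q_nonzero by (intro Suc.IH) (auto simp: norm_divide field_simps)
    then show ?case
      using theta_scale[of "x / q"] Suc.prems(1) q_nonzero by simp
  qed
  have "theta q x = 0" if "x \<noteq> 0" for x
  proof -
    obtain k where "norm x / e < norm q ^ k" using real_arch_pow[OF q] by blast
    then show ?thesis using zero[OF that, of k] e(1) by (simp add: field_simps)
  qed
  with theta_not_zero show False by blast
qed

lemma theta_powi_scale: "z \<noteq> 0 \<Longrightarrow> theta q (q * z) powi k = z powi k * theta q z powi k"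
  by (simp add: theta_scale power_int_mult_distrib)

lemma mero_germ_qchar [mero_germ_intros]:
  assumes "c \<noteq> 0"
  shows "mero_germ (qchar q c)"
  unfolding qchar_def
  using mero_germ_scale[OF _ mero_germ_theta, of "1 / c"] assms
  by (auto intro!: mero_germ_intros)

lemma qchar_scale:
  assumes "c \<noteq> 0" "z \<noteq> 0"
  shows "qchar q c (q * z) = c * qchar q c z"
  using theta_scale[of z] theta_scale[of "z / c"] assms by (simp add: qchar_def)

lemma eventually_qchar_nonzero:
  assumes "c \<noteq> 0"
  shows "\<forall>\<^sub>F z in punctured_germ. qchar q c z \<noteq> 0"
proof -
  have "\<forall>\<^sub>F z in punctured_germ. theta q (1 / c * z) \<noteq> 0"
    using assms by (intro eventually_punctured_germ_scale eventually_theta_nonzero) auto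
  with eventually_theta_nonzero show ?thesis
    by eventually_elim (simp add: qchar_def)
qed

lemma mero_germ_qlog [mero_germ_intros]: "mero_germ (qlog q)"
  unfolding qlog_def by (intro mero_germ_intros)

text \<open>The logarithmic derivative of the functional equation of theta.\<close>

lemma qlog_scale: "\<forall>\<^sub>F z in punctured_germ. qlog q (q * z) = qlog q z + 1"
  using eventually_neq_0_punctured_germ eventually_theta_nonzero
proof eventually_elim
  case (elim z)
  have fd: "theta q field_differentiable at x" if "x \<noteq> 0" for x
    using analytic_on_imp_differentiable_at[OF theta_analytic[OF that]] by simp
  have "((\<lambda>z. q * z) has_field_derivative q) (at z)"
    by (auto intro!: derivative_eq_intros)
  moreover have "(theta q has_field_derivative deriv (theta q) (q * z)) (at (q * z))"
    using fd[of "q * z"] elim q_nonzero by (simp add: DERIV_deriv_iff_field_differentiable)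
  ultimately have d1: "((\<lambda>z. theta q (q * z)) has_field_derivative (q * deriv (theta q) (q * z))) (at z)"
    using DERIV_chain2 by (metis mult.commute)
  have d2: "((\<lambda>z. z * theta q z) has_field_derivative (theta q z + z * deriv (theta q) z)) (at z)"
    using fd[OF elim(1)] by (auto simp: DERIV_deriv_iff_field_differentiable intro!: derivative_eq_intros)
  have ev: "\<forall>\<^sub>F z in nhds z. theta q (q * z) = z * theta q z"
    using t1_space_nhds[OF elim(1)] by eventually_elim (rule theta_scale)
  have "q * deriv (theta q) (q * z) = theta q z + z * deriv (theta q) z"
    using DERIV_unique[OF _ d2] d1 DERIV_cong_ev[OF refl ev refl] by blast
  then have "q * z * deriv (theta q) (q * z) = z * (theta q z + z * deriv (theta q) z)"
    by (metis mult.assoc mult.commute)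
  then show ?case
    using elim by (simp add: qlog_def theta_scale field_simps)
qed

lemma mero_germ_qlog_gchoose [mero_germ_intros]: "mero_germ (\<lambda>z. qlog q z gchoose k)"
  unfolding gbinomial_prod_rev by (intro mero_germ_intros)

end

section \<open>Operators whose last slope is 0\<close>

lemma mero_germ_cong:
  assumes "mero_germ f" "\<forall>\<^sub>F z in punctured_germ. f z = g z"
  shows "mero_germ g"
proof -
  have "\<forall>\<^sub>F x in at 0. \<forall>\<^sub>F z in at x. f z = g z"
    using assms(2) by (simp add: eventually_punctured_germ)
  with assms(1) show ?thesis
    unfolding mero_germ_def
  proof eventually_elim
    case (elim x)
    then show ?case using meromorphic_on_cong[of "{x}" f g "{x}"] by simp
  qed
qed

text \<open>
  The twists \<open>w * E * (qlog q gchoose k)\<close> of meromorphic germs \<open>w\<close> at 0 span a space on which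
  \<open>\<sigma>\<^sub>q - 1\<close> is surjective, see \<open>qspace_solvable\<close>.
\<close>

inductive qspace :: "complex \<Rightarrow> (complex \<Rightarrow> complex) \<Rightarrow> bool" for q where
  twist: "w meromorphic_on {0} \<Longrightarrow> mero_germ E \<Longrightarrow> \<gamma> \<noteq> 0 \<Longrightarrow>
    \<forall>\<^sub>F z in punctured_germ. E (q * z) = \<gamma> * E z \<Longrightarrow>
    qspace q (\<lambda>z. w z * E z * (qlog q z gchoose k))"
| add: "qspace q f \<Longrightarrow> qspace q g \<Longrightarrow> qspace q (\<lambda>z. f z + g z)"
| cong: "qspace q f \<Longrightarrow> \<forall>\<^sub>F z in punctured_germ. f z = g z \<Longrightarrow> qspace q g"

lemma qspace_const: "qspace q (\<lambda>_. c)"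
  using qspace.twist[of "\<lambda>_. c" "\<lambda>_. 1" 1 q 0]
  by (simp add: mero_germ_intros meromorphic_on_const)

context
  fixes q :: complex
  assumes q: "norm q > 1"
begin

lemma qspace_mero_germ: "qspace q f \<Longrightarrow> mero_germ f"
proof (induction rule: qspace.induct)
  case (cong f g)
  show ?case using cong.IH cong.hyps(2) by (rule mero_germ_cong)
next
  case (twist w E \<gamma> k)
  show ?case
    by (intro mero_germ_mult mero_germ_qlog_gchoose[OF q] meromorphic_at_0_imp_mero_germ[OF twist(1)] twist(2))
qed (rule mero_germ_add)

text \<open>The multipliers \<open>c\<close> and \<open>\<gamma>\<close> simply multiply. This
  serves to undo the substitution by \<open>qchar q c * h\<close> without leaving the space.\<close>

lemma qspace_mult:
  assumes "qspace q f" and u: "u meromorphic_on {0}"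
    and e: "mero_germ e" "c \<noteq> 0" "\<forall>\<^sub>F z in punctured_germ. e (q * z) = c * e z"
  shows "qspace q (\<lambda>z. e z * u z * f z)"
  using assms(1)
proof (induction rule: qspace.induct)
  case (twist w E \<gamma> k)
  have "\<forall>\<^sub>F z in punctured_germ. e (q * z) * E (q * z) = (c * \<gamma>) * (e z * E z)"
    using twist(4) e(3) by eventually_elim simp
  then have "qspace q (\<lambda>z. (u z * w z) * (e z * E z) * (qlog q z gchoose k))"
    using twist e u by (intro qspace.twist[of _ _ "c * \<gamma>"]) (auto intro: meromorphic_intros mero_germ_intros)
  then show ?case by (simp only: mult_ac)
next
  case (add f g)
  then show ?case using qspace.add[OF add.IH] by (simp add: algebra_simps)
next
  case (cong f g)
  show ?case
    by (rule qspace.cong[OF cong.IH]) (use cong(2) in \<open>auto elim: eventually_mono\<close>)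
qed

text \<open>For \<open>y * E * (l gchoose Suc k)\<close> with \<open>l = qlog q\<close>, the
  first-order equation matches the target up to two errors. The resonant monomial is corrected by
  raising the binomial index by one; the cross term from Pascal's rule has index \<open>k\<close>
  and falls to the induction hypothesis.\<close>

lemma qspace_twist_solvable:
  assumes E: "mero_germ E" "\<gamma> \<noteq> 0" "\<forall>\<^sub>F z in punctured_germ. E (q * z) = \<gamma> * E z"
    and w: "w meromorphic_on {0}"
  shows "\<exists>f. qspace q f \<and>
    (\<forall>\<^sub>F z in punctured_germ. f (q * z) - f z = w z * E z * (qlog q z gchoose k))"
  using w
proof (induction k arbitrary: w)
  case (0 w)
  obtain y s and m :: int where y: "y meromorphic_on {0}"
    "\<forall>\<^sub>F z in at 0. \<gamma> * y (q * z) - y z = w z - s * z powi m" "s \<noteq> 0 \<Longrightarrow> \<gamma> * q powi m = 1"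
    by (rule first_order_meromorphic[OF q E(2) 0]) blast
  \<comment> \<open>By resonance \<open>s * z powi m * E z\<close> is invariant under the shift, so
    its product with \<open>qlog q\<close> has it as difference.\<close>
  define f where "f z = y z * E z * (qlog q z gchoose 0) + (s * z powi m) * E z * (qlog q z gchoose 1)" for z
  have "qspace q f"
    unfolding f_def
    by (intro qspace.add qspace.twist[OF _ E] y(1) meromorphic_intros)
  moreover have "\<forall>\<^sub>F z in punctured_germ. f (q * z) - f z = w z * E z * (qlog q z gchoose 0)"
    using E(3) eventually_at_0_imp_punctured_germ[OF y(2)] qlog_scale[OF q]
  proof eventually_elim
    case (elim z)
    have s: "s * \<gamma> * q powi m = s" using y(3) by (cases "s = 0") auto
    have "f (q * z) - f z = (\<gamma> * y (q * z) - y z) * E z + (s * \<gamma> * q powi m) * z powi m * E z * (qlog q z + 1)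
        - s * z powi m * E z * qlog q z"
      unfolding f_def elim(1,3) power_int_mult_distrib by (simp add: algebra_simps)
    also have "\<dots> = w z * E z" unfolding s elim(2) by (simp add: algebra_simps)
    finally show ?case by simp
  qed
  ultimately show ?case by blast
next
  case (Suc k w)
  obtain y s and m :: int where y: "y meromorphic_on {0}"
    "\<forall>\<^sub>F z in at 0. \<gamma> * y (q * z) - y z = w z - s * z powi m" "s \<noteq> 0 \<Longrightarrow> \<gamma> * q powi m = 1"
    by (rule first_order_meromorphic[OF q E(2) Suc.prems]) blast
  \<comment> \<open>The negative of the cross term, to be cancelled by \<open>g\<close>.\<close>
  have "(\<lambda>z. - \<gamma> * y (q * z)) meromorphic_on {0}"
    using y(1) meromorphic_on_scale[of y q 0] by (auto intro!: meromorphic_intros)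
  from Suc.IH[OF this] obtain g where g: "qspace q g"
    "\<forall>\<^sub>F z in punctured_germ. g (q * z) - g z = - \<gamma> * y (q * z) * E z * (qlog q z gchoose k)"
    by blast
  define L where "L j z = qlog q z gchoose j" for j z
  define f where "f z = y z * E z * L (Suc k) z + (s * z powi m) * E z * L (Suc (Suc k)) z + g z" for z
  have "qspace q f"
    unfolding f_def L_def
    by (intro qspace.add qspace.twist[OF _ E] y(1) g(1) meromorphic_intros)
  moreover have "\<forall>\<^sub>F z in punctured_germ. f (q * z) - f z = w z * E z * (qlog q z gchoose (Suc k))"
    using E(3) eventually_at_0_imp_punctured_germ[OF y(2)] qlog_scale[OF q] g(2)
  proof eventually_elim
    case (elim z)
    have s: "s * \<gamma> * q powi m = s" using y(3) by (cases "s = 0") auto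
    have L: "L (Suc j) (q * z) = L j z + L (Suc j) z" for j
      unfolding L_def elim by (rule gbinomial_Suc_Suc)
    have "f (q * z) - f z = (\<gamma> * y (q * z) - y z) * E z * L (Suc k) z + \<gamma> * y (q * z) * E z * L k z +
        (s * \<gamma> * q powi m) * z powi m * E z * (L (Suc k) z + L (Suc (Suc k)) z)
        - s * z powi m * E z * L (Suc (Suc k)) z + (g (q * z) - g z)"
      unfolding f_def L elim(1) power_int_mult_distrib by (simp add: algebra_simps)
    also have "\<dots> = w z * E z * L (Suc k) z"
      unfolding s elim(2,4) L_def by (simp add: algebra_simps)
    finally show ?case by (simp add: L_def)
  qed
  ultimately show ?case by blast
qed

lemma qspace_solvable:
  assumes "qspace q g"
  shows "\<exists>f. qspace q f \<and> (\<forall>\<^sub>F z in punctured_germ. f (q * z) - f z = g z)"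
  using assms
proof (induction rule: qspace.induct)
  case (twist w E \<gamma> k)
  then show ?case using qspace_twist_solvable by blast
next
  case (add g1 g2)
  then obtain f1 f2 where f: "qspace q f1" "\<forall>\<^sub>F z in punctured_germ. f1 (q * z) - f1 z = g1 z"
    "qspace q f2" "\<forall>\<^sub>F z in punctured_germ. f2 (q * z) - f2 z = g2 z" by blast
  have "\<forall>\<^sub>F z in punctured_germ. (f1 (q * z) + f2 (q * z)) - (f1 z + f2 z) = g1 z + g2 z"
    using f(2,4) by eventually_elim (simp add: algebra_simps)
  then show ?case using qspace.add[OF f(1,3)] by (intro exI[of _ "\<lambda>z. f1 z + f2 z"]) auto
next
  case (cong g1 g2)
  then obtain f where f: "qspace q f" "\<forall>\<^sub>F z in punctured_germ. f (q * z) - f z = g1 z" by blast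
  have "\<forall>\<^sub>F z in punctured_germ. f (q * z) - f z = g2 z"
    using f(2) cong(2) by eventually_elim simp
  with f(1) show ?case by blast
qed

end

text \<open>Removing the factor \<open>x ^ k\<close> leaves a nonconstant polynomial with nonzero
  constant term. It has roots, finitely many and none of them 0.\<close>

lemma maximal_root:
  fixes \<beta> :: "nat \<Rightarrow> complex"
  assumes "k < n" "\<beta> n \<noteq> 0" "\<beta> k \<noteq> 0" "\<And>i. i < k \<Longrightarrow> \<beta> i = 0"
  obtains c where "c \<noteq> 0" "(\<Sum>i\<le>n. \<beta> i * c ^ i) = 0"
    "\<And>x. norm x > norm c \<Longrightarrow> (\<Sum>i\<le>n. \<beta> i * x ^ i) \<noteq> 0"
proof -
  define p where "p = (\<Sum>i\<le>n - k. monom (\<beta> (k + i)) i)"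
  have coeff: "coeff p j = \<beta> (k + j)" if "j \<le> n - k" for j
    using that by (simp add: p_def coeff_sum coeff_monom)
  have eq: "(\<Sum>i\<le>n. \<beta> i * x ^ i) = x ^ k * poly p x" for x
  proof -
    have "(\<Sum>i\<le>n. \<beta> i * x ^ i) = (\<Sum>i\<in>{k..n}. \<beta> i * x ^ i)"
      using assms by (intro sum.mono_neutral_right) auto
    also have "\<dots> = (\<Sum>i\<le>n - k. \<beta> (k + i) * x ^ (k + i))"
      using assms(1) by (intro sum.reindex_bij_witness[of _ "\<lambda>i. k + i" "\<lambda>i. i - k"]) auto
    finally show ?thesis
      by (simp add: p_def poly_sum poly_monom sum_distrib_left power_add mult_ac)
  qed
  have "coeff p (n - k) \<noteq> 0" using coeff[of "n - k"] assms by simp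
  then have deg: "degree p > 0" using le_degree[of p "n - k"] assms(1) by simp
  then have "p \<noteq> 0" by auto
  have fin: "finite {x. poly p x = 0}" by (rule poly_roots_finite[OF \<open>p \<noteq> 0\<close>])
  have "\<exists>x. poly p x = 0"
    using deg by (intro fundamental_theorem_of_algebra) (simp add: constant_degree)
  then have ne: "norm ` {x. poly p x = 0} \<noteq> {}" by blast
  then obtain c where c: "poly p c = 0" "norm c = Max (norm ` {x. poly p x = 0})"
    using Max_in[OF finite_imageI[OF fin] ne] by (metis (mono_tags, lifting) imageE mem_Collect_eq)
  have max: "norm x \<le> norm c" if "poly p x = 0" for x
    unfolding c(2) using that fin by (intro Max_ge) auto
  have "poly p 0 \<noteq> 0" using coeff[of 0] assms(3) by (simp add: poly_0_coeff_0)
  then have "c \<noteq> 0" using c(1) by auto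
  show ?thesis
  proof (rule that[OF \<open>c \<noteq> 0\<close>])
    show "(\<Sum>i\<le>n. \<beta> i * c ^ i) = 0" unfolding eq using c(1) by simp
    show "(\<Sum>i\<le>n. \<beta> i * x ^ i) \<noteq> 0" if "norm x > norm c" for x
      unfolding eq using max[of x] that by auto
  qed
qed

lemma abel_summation:
  fixes \<beta> F :: "nat \<Rightarrow> 'a :: comm_ring"
  shows "(\<Sum>i\<le>n. \<beta> i * F i) = (\<Sum>k\<le>n. \<beta> k) * F n - (\<Sum>i<n. (\<Sum>k\<le>i. \<beta> k) * (F (Suc i) - F i))"
  by (induction n) (simp_all add: algebra_simps)

lemma lin_indep_punctured_nbhds_iff:
  "lin_indep_over_constants q (punctured nbhds_of_0) r f \<longleftrightarrow>
    (\<forall>c. (\<forall>j<r. mero_germ (c j) \<and> (\<forall>\<^sub>F z in punctured_germ. c j (q * z) = c j z)) \<longrightarrow>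
      (\<forall>\<^sub>F z in punctured_germ. (\<Sum>j<r. c j z * f j z) = 0) \<longrightarrow>
      (\<forall>j<r. \<forall>\<^sub>F z in punctured_germ. c j z = 0))"
  unfolding lin_indep_over_constants_def q_constants_def
  by (auto simp: mero_punctured_nbhds_iff mero_eq_punctured_nbhds_iff qshift_def)

text \<open>
  Let \<open>c\<close> be a nonzero root of largest modulus of \<open>\<Sum>i. b i 0 * x ^ i\<close> and \<open>h\<close> the corresponding Adams
  solution. Substituting \<open>f = qchar q c * h * F\<close> turns the operator into one that annihilates
  constants, hence into \<open>Q (\<sigma>\<^sub>q - 1)\<close>, where \<open>Q\<close> has order \<open>n - 1\<close> and its coefficients \<open>d\<close> are
  partial sums.
\<close>

lemma normal_form_solutions:
  fixes q :: complex and b :: "nat \<Rightarrow> complex \<Rightarrow> complex"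
  assumes q: "norm q > 1"
  shows "r \<le> n \<Longrightarrow> (\<And>i. i \<le> n \<Longrightarrow> b i analytic_on {0}) \<Longrightarrow> b n 0 \<noteq> 0 \<Longrightarrow> b (n - r) 0 \<noteq> 0 \<Longrightarrow>
    (\<And>i. i < n - r \<Longrightarrow> b i 0 = 0) \<Longrightarrow>
    \<exists>f. (\<forall>j<r. qspace q (f j) \<and> (\<forall>\<^sub>F z in punctured_germ. (\<Sum>i\<le>n. b i z * f j (q ^ i * z)) = 0)) \<and>
      lin_indep_over_constants q (punctured nbhds_of_0) r f"
proof (induction r arbitrary: n b)
  case 0
  then show ?case by (simp add: lin_indep_punctured_nbhds_iff)
next
  case (Suc r)
  have q0: "q \<noteq> 0" using q by auto
  \<comment> \<open>The polynomial with coefficients \<open>b i 0\<close> has degree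
    \<open>n\<close> and is divisible exactly by \<open>x ^ k\<close>, so it has
    \<open>Suc r\<close> nonzero roots with multiplicity.\<close>
  define k where "k = n - Suc r"
  have k: "k < n" "b k 0 \<noteq> 0" "\<And>i. i < k \<Longrightarrow> b i 0 = 0"
    using Suc.prems by (auto simp: k_def)
  obtain c where c: "c \<noteq> 0" "(\<Sum>i\<le>n. b i 0 * c ^ i) = 0"
    "\<And>x. norm x > norm c \<Longrightarrow> (\<Sum>i\<le>n. b i 0 * x ^ i) \<noteq> 0"
    using maximal_root[of k n "\<lambda>i. b i 0"] k Suc.prems(3) by metis
  obtain h where h: "h analytic_on {0}" "h 0 = 1"
    "\<forall>\<^sub>F z in nhds 0. (\<Sum>i\<le>n. b i z * c ^ i * h (q ^ i * z)) = 0"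
  proof (rule adams_convergent_solution[OF q, of n "\<lambda>i z. b i z * c ^ i"])
    fix m :: nat assume m: "m \<ge> 1"
    have "norm (c * q ^ m) > norm c"
      using c(1) q m by (simp add: norm_mult norm_power one_less_power)
    from c(3)[OF this] show "(\<Sum>i\<le>n. b i 0 * c ^ i * (q ^ m) ^ i) \<noteq> 0"
      by (simp add: power_mult_distrib mult.assoc)
  qed (use Suc.prems c in \<open>auto intro!: analytic_intros\<close>)
  define \<beta> where "\<beta> i z = b i z * c ^ i * h (q ^ i * z)" for i z
  define d where "d m z = (\<Sum>i\<le>m. \<beta> i z)" for m z
  have hscale: "(\<lambda>z. h (q ^ i * z)) analytic_on {0}" for i
    using analytic_on_compose_gen[of "\<lambda>z. q ^ i * z" "{0}" h "{0}"] h(1)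
    by (auto simp: o_def intro: analytic_intros)
  have \<beta>_an: "\<beta> i analytic_on {0}" if "i \<le> n" for i
    unfolding \<beta>_def using Suc.prems(2)[OF that] hscale by (intro analytic_intros) auto
  have \<beta>_0: "\<beta> i 0 = b i 0 * c ^ i" for i
    by (simp add: \<beta>_def h(2))
  have d_n: "\<forall>\<^sub>F z in nhds 0. d n z = 0"
    using h(3) by (simp add: d_def \<beta>_def)
  obtain n' where n': "n = Suc n'" using k(1) by (cases n) auto
  \<comment> \<open>At \<open>z = 0\<close> the \<open>d i\<close> are, up to sign, the coefficients
    of the polynomial of the \<open>\<beta> i 0\<close> divided by \<open>x - 1\<close>. The lowest
    nonzero index stays \<open>k\<close> while the degree drops to \<open>n'\<close>, so one nonzero
    root is gone.\<close>
  have "\<exists>g. (\<forall>j<r. qspace q (g j) \<and> (\<forall>\<^sub>F z in punctured_germ. (\<Sum>i\<le>n'. d i z * g j (q ^ i * z)) = 0)) \<and>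
      lin_indep_over_constants q (punctured nbhds_of_0) r g"
  proof (rule Suc.IH)
    show "r \<le> n'" using Suc.prems(1) n' by simp
    show "d i analytic_on {0}" if "i \<le> n'" for i
      unfolding d_def using that n' by (intro analytic_intros \<beta>_an) auto
    have "d n 0 = 0" using eventually_nhds_x_imp_x[OF d_n] .
    then have "d n' 0 = - (b n 0 * c ^ n)"
      unfolding d_def n' by (simp add: \<beta>_0 eq_neg_iff_add_eq_0)
    then show "d n' 0 \<noteq> 0" using Suc.prems(3) c(1) by simp
    have nk: "n' - r = k" by (simp add: k_def n')
    have lower: "d i 0 = 0" if "i < k" for i
      unfolding d_def using that by (auto simp: \<beta>_0 k(3))
    then show "d i 0 = 0" if "i < n' - r" for i using that nk by simp
    have "(\<Sum>i\<le>k. \<beta> i 0) = (\<Sum>i\<in>{k}. \<beta> i 0)"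
      by (rule sum.mono_neutral_right) (auto simp: \<beta>_0 k(3))
    then show "d (n' - r) 0 \<noteq> 0" unfolding nk d_def using k(2) c(1) by (simp add: \<beta>_0)
  qed
  then obtain g where g: "\<And>j. j < r \<Longrightarrow> qspace q (g j)"
    "\<And>j. j < r \<Longrightarrow> \<forall>\<^sub>F z in punctured_germ. (\<Sum>i\<le>n'. d i z * g j (q ^ i * z)) = 0"
    "lin_indep_over_constants q (punctured nbhds_of_0) r g" by blast
  have "\<forall>j. \<exists>F. j < r \<longrightarrow> qspace q F \<and> (\<forall>\<^sub>F z in punctured_germ. F (q * z) - F z = g j z)"
    using qspace_solvable[OF q] g(1) by blast
  then obtain F' where F': "\<And>j. j < r \<Longrightarrow> qspace q (F' j)"
    "\<And>j. j < r \<Longrightarrow> \<forall>\<^sub>F z in punctured_germ. F' j (q * z) - F' j z = g j z" by metis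
  \<comment> \<open>Index 0 carries the constant 1, killed by \<open>\<sigma>\<^sub>q - 1\<close>,
    and yields the solution \<open>qchar q c * h\<close>; the other indices are primitives of the
    solutions of the quotient.\<close>
  define F where "F = case_nat (\<lambda>_. 1) F'"
  define G where "G = case_nat (\<lambda>_. 0) g"
  have F_qspace: "qspace q (F j)" if "j < Suc r" for j
    using that F'(1) by (cases j) (auto simp: F_def qspace_const)
  have F_diff: "\<forall>\<^sub>F z in punctured_germ. F j (q * z) - F j z = G j z" if "j < Suc r" for j
    using that F'(2) by (cases j) (auto simp: F_def G_def)
  have G: "\<forall>\<^sub>F z in punctured_germ. (\<Sum>i\<le>n'. d i z * G j (q ^ i * z)) = 0" if "j < Suc r" for j
    using that g(2) by (cases j) (auto simp: G_def)
  define f where "f j z = qchar q c z * h z * F j z" for j z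
  have "qspace q (f j)" if "j < Suc r" for j
    unfolding f_def
  proof (rule qspace_mult[OF q F_qspace[OF that] _ mero_germ_qchar[OF q c(1)] c(1)])
    show "h meromorphic_on {0}" using h(1) by (rule analytic_on_imp_meromorphic_on)
    show "\<forall>\<^sub>F z in punctured_germ. qchar q c (q * z) = c * qchar q c z"
      using eventually_neq_0_punctured_germ by eventually_elim (rule qchar_scale[OF q c(1)])
  qed
  moreover have "\<forall>\<^sub>F z in punctured_germ. (\<Sum>i\<le>n. b i z * f j (q ^ i * z)) = 0" if "j < Suc r" for j
  proof -
    have "\<forall>\<^sub>F z in punctured_germ. \<forall>i\<in>{..n'}. F j (q * (q ^ i * z)) - F j (q ^ i * z) = G j (q ^ i * z)"
      by (intro eventually_ball_finite ballI eventually_punctured_germ_scale[OF _ F_diff[OF that]])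
         (use q0 in auto)
    moreover have "\<forall>\<^sub>F z in punctured_germ. d n z = 0"
      by (intro eventually_at_0_imp_punctured_germ filter_leD[OF at_within_le_nhds d_n])
    ultimately show ?thesis
      using G[OF that] eventually_neq_0_punctured_germ
    proof eventually_elim
      case (elim z)
      have qc: "qchar q c (q ^ i * z) = c ^ i * qchar q c z" for i
        using qchar_scale[OF q c(1), of "q ^ _ * z"] elim(4) q0
        by (induction i) (auto simp: mult.assoc)
      have "(\<Sum>i\<le>n. b i z * f j (q ^ i * z)) = qchar q c z * (\<Sum>i\<le>n. \<beta> i z * F j (q ^ i * z))"
        unfolding f_def qc \<beta>_def sum_distrib_left by (intro sum.cong) (auto simp: mult_ac)
      also have "(\<Sum>i\<le>n. \<beta> i z * F j (q ^ i * z)) =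
          d n z * F j (q ^ n * z) - (\<Sum>i<n. d i z * (F j (q ^ Suc i * z) - F j (q ^ i * z)))"
        unfolding d_def by (rule abel_summation)
      also have "(\<Sum>i<n. d i z * (F j (q ^ Suc i * z) - F j (q ^ i * z))) = (\<Sum>i\<le>n'. d i z * G j (q ^ i * z))"
        unfolding n' lessThan_Suc_atMost using elim(1) by (intro sum.cong) (auto simp: mult.assoc)
      finally show ?case using elim(2,3) by simp
    qed
  qed
  moreover have "lin_indep_over_constants q (punctured nbhds_of_0) (Suc r) f"
    unfolding lin_indep_punctured_nbhds_iff
  proof (intro allI impI)
    fix C j
    assume C: "\<forall>j<Suc r. mero_germ (C j) \<and> (\<forall>\<^sub>F z in punctured_germ. C j (q * z) = C j z)"
      and zero: "\<forall>\<^sub>F z in punctured_germ. (\<Sum>j<Suc r. C j z * f j z) = 0" and j: "j < Suc r"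
    define S where "S z = (\<Sum>j<Suc r. C j z * F j z)" for z
    have "isCont h 0" using h(1) by (rule analytic_at_imp_isCont)
    then have "\<forall>\<^sub>F z in at 0. h z \<noteq> 0"
      using h(2) tendsto_imp_eventually_ne[of h 1 "at 0" 0] by (simp add: isCont_def)
    then have "\<forall>\<^sub>F z in punctured_germ. h z \<noteq> 0" by (rule eventually_at_0_imp_punctured_germ)
    then have S0: "\<forall>\<^sub>F z in punctured_germ. S z = 0"
      using eventually_qchar_nonzero[OF q c(1)] zero
    proof eventually_elim
      case (elim z)
      have "(\<Sum>j<Suc r. C j z * f j z) = qchar q c z * h z * S z"
        unfolding f_def S_def sum_distrib_left by (intro sum.cong) (auto simp: mult_ac)
      then show ?case using elim by simp
    qed
    \<comment> \<open>Applying \<open>\<sigma>\<^sub>q - 1\<close> to the relation \<open>S\<close>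
      treats the \<open>C j\<close> as scalars and removes \<open>C 0\<close>, since
      \<open>F 0\<close> is constant; what remains is a relation among the
      \<open>g j\<close>.\<close>
    have "\<forall>\<^sub>F z in punctured_germ. \<forall>j\<in>{..<Suc r}. F j (q * z) - F j z = G j z"
      by (intro eventually_ball_finite ballI F_diff) auto
    moreover have "\<forall>\<^sub>F z in punctured_germ. \<forall>j\<in>{..<Suc r}. C j (q * z) = C j z"
      by (intro eventually_ball_finite ballI) (use C in auto)
    ultimately have "\<forall>\<^sub>F z in punctured_germ. (\<Sum>j<r. C (Suc j) z * g j z) = 0"
      using S0 eventually_punctured_germ_scale[OF q0 S0]
    proof eventually_elim
      case (elim z)
      have "S (q * z) - S z = (\<Sum>j<Suc r. C j z * (F j (q * z) - F j z))"
        unfolding S_def sum_subtractf[symmetric] using elim(2)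
        by (intro sum.cong) (auto simp: right_diff_distrib)
      also have "\<dots> = (\<Sum>j<Suc r. C j z * G j z)"
        using elim(1) by (intro sum.cong) auto
      also have "\<dots> = (\<Sum>j<r. C (Suc j) z * g j z)"
        by (simp add: sum.lessThan_Suc_shift G_def del: sum.lessThan_Suc)
      finally show ?case using elim(3,4) by simp
    qed
    then have C_Suc: "\<forall>j<r. \<forall>\<^sub>F z in punctured_germ. C (Suc j) z = 0"
      using g(3)[unfolded lin_indep_punctured_nbhds_iff, rule_format, of "\<lambda>j. C (Suc j)"] C by auto
    have "\<forall>\<^sub>F z in punctured_germ. \<forall>j\<in>{..<r}. C (Suc j) z = 0"
      by (intro eventually_ball_finite ballI) (use C_Suc in auto)
    with S0 have "\<forall>\<^sub>F z in punctured_germ. C 0 z = 0"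
      by eventually_elim (simp add: S_def F_def sum.lessThan_Suc_shift del: sum.lessThan_Suc)
    with C_Suc j show "\<forall>\<^sub>F z in punctured_germ. C j z = 0" by (cases j) auto
  qed
  ultimately show ?case by blast
qed

section \<open>Extension to the punctured plane\<close>

lemma meromorphic_eq_0_if_germ_eq_0:
  assumes "f meromorphic_on (U - {0})" "open U" "connected U" "0 \<in> U"
    and "\<forall>\<^sub>F z in punctured_germ. f z = 0"
  shows "\<forall>\<^sub>\<approx>z\<in>U - {0}. f z = 0"
proof -
  have "connected (U - {0})"
    using assms by (intro connected_open_delete) auto
  then have "(\<forall>\<^sub>\<approx>z\<in>U - {0}. f z = 0) \<or> (\<forall>\<^sub>\<approx>z\<in>U - {0}. f z \<noteq> 0)"
    using assms by (intro meromorphic_imp_constant_or_avoid) (auto simp: open_delete)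
  moreover have False if "\<forall>\<^sub>\<approx>z\<in>U - {0}. f z \<noteq> 0"
  proof -
    have "\<forall>\<^sub>F z in punctured_germ. f z \<noteq> 0"
      using that assms(2,4) by (rule eventually_cosparse_imp_punctured_germ)
    with assms(5) have "\<forall>\<^sub>F z in punctured_germ. False" by eventually_elim simp
    then show False using punctured_germ_neq_bot by simp
  qed
  ultimately show ?thesis by blast
qed

text \<open>The equation at \<open>z / q ^ n\<close>, solved for its top term, expresses f(z)
  through values at points of modulus at most \<open>norm z / norm q\<close>. The right-hand side is
  therefore defined on a disc larger by the factor \<open>norm q\<close>.\<close>

lemma extend_solution_step:
  fixes q :: complex
  assumes q: "norm q > 1"
    and a: "\<And>i. i \<le> n \<Longrightarrow> a i meromorphic_on UNIV"
    and lead: "\<forall>\<^sub>F z in punctured_germ. a n z \<noteq> 0"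
    and f: "f meromorphic_on (ball 0 R - {0})"
    and eq: "\<forall>\<^sub>F z in punctured_germ. (\<Sum>i\<le>n. a i z * f (q ^ i * z)) = 0"
  obtains g where "g meromorphic_on (ball 0 (norm q * R) - {0})"
    "\<forall>\<^sub>F z in punctured_germ. g z = f z"
proof -
  have q0: "q \<noteq> 0" using q by auto
  define p where "p = inverse (q ^ n)"
  have p: "p \<noteq> 0" "q ^ n * p = 1" using q0 by (simp_all add: p_def)
  define g where "g z = - (\<Sum>i<n. a i (p * z) * f (q ^ i * (p * z))) / a n (p * z)" for z
  have "g meromorphic_on {x}" if x: "x \<in> ball 0 (norm q * R) - {0}" for x
  proof -
    have "(\<lambda>z. a i (p * z)) meromorphic_on {x}" if "i \<le> n" for i
      by (rule meromorphic_on_scale) (rule meromorphic_on_subset[OF a[OF that]], simp)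
    moreover have "(\<lambda>z. f (q ^ i * (p * z))) meromorphic_on {x}" if "i < n" for i
    proof -
      have "norm (q ^ i * p * x) < R"
      proof -
        have "norm q * (norm q ^ i * norm p) \<le> norm q ^ n * norm p"
          using power_increasing[of "Suc i" n "norm q"] q that
          by (simp add: mult.assoc[symmetric] mult_right_mono)
        also have "\<dots> = 1" using p(2) by (metis norm_mult norm_one norm_power)
        finally have "norm q * norm (q ^ i * p * x) \<le> norm x"
          using mult_right_mono[of "norm q * (norm q ^ i * norm p)" 1 "norm x"]
          by (simp add: norm_mult norm_power mult.assoc)
        also have "norm x < norm q * R" using x by simp
        finally show ?thesis by (rule mult_left_less_imp_less) simp
      qed
      then have "q ^ i * p * x \<in> ball 0 R - {0}" using x p q0 by simp
      then have "f meromorphic_on {q ^ i * p * x}"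
        by (intro meromorphic_on_subset[OF f]) auto
      from meromorphic_on_scale[OF this] show ?thesis by (simp add: mult.assoc)
    qed
    ultimately show ?thesis
      unfolding g_def by (intro meromorphic_intros) auto
  qed
  then have "g meromorphic_on (ball 0 (norm q * R) - {0})"
    using meromorphic_on_meromorphic_at by blast
  moreover have "\<forall>\<^sub>F z in punctured_germ. g z = f z"
    using eventually_punctured_germ_scale[OF p(1) lead] eventually_punctured_germ_scale[OF p(1) eq]
  proof eventually_elim
    case (elim z)
    have "(\<Sum>i<n. a i (p * z) * f (q ^ i * (p * z))) + a n (p * z) * f z = 0"
      using elim(2) p(2) by (simp add: lessThan_Suc_atMost[symmetric] mult.assoc[symmetric] del: lessThan_Suc_atMost)
    then show ?case using elim(1) by (simp add: g_def field_simps add_eq_0_iff)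
  qed
  ultimately show ?thesis using that by blast
qed

text \<open>The \<open>g k\<close> agree only off sparse sets, so their values cannot be glued
  directly. \<open>remove_sings\<close> selects canonical values, and \<open>F\<close> then
  coincides on each entire punctured disc with one function, whatever the value of
  \<open>K\<close>.\<close>

lemma extend_germ_if_all_balls:
  assumes "\<And>k::nat. g k meromorphic_on (ball 0 (R k) - {0})" "\<And>k. \<forall>\<^sub>F z in punctured_germ. g k z = f z"
    and R: "mono R" "R 0 > 0" "\<And>x. \<exists>k. x < R k"
  obtains F where "F meromorphic_on (UNIV - {0})" "\<forall>\<^sub>F z in punctured_germ. F z = f z"
proof -
  define K where "K z = (LEAST k. norm z < R k)" for z :: complex
  define F where "F z = remove_sings (g (K z)) z" for z
  have Rpos: "R k > 0" for k
    using R(2) monoD[OF R(1), of 0 k] by simp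
  have F_eq: "F z = remove_sings (g k) z" if "z \<in> ball 0 (R k) - {0}" for z k
  proof -
    have z: "norm z < R k" "z \<noteq> 0" using that by auto
    have K: "K z \<le> k" "norm z < R (K z)"
      unfolding K_def using z(1) by (auto intro: Least_le LeastI)
    let ?B = "ball (0::complex) (R (K z))"
    have "g k meromorphic_on (?B - {0})"
      by (rule meromorphic_on_subset[OF assms(1)[of k]]) (use monoD[OF R(1) K(1)] in auto)
    then have "(\<lambda>z'. g (K z) z' - g k z') meromorphic_on (?B - {0})"
      by (intro meromorphic_intros assms(1))
    moreover have "\<forall>\<^sub>F z' in punctured_germ. g (K z) z' - g k z' = 0"
      using assms(2)[of "K z"] assms(2)[of k] by eventually_elim simp
    ultimately have "\<forall>\<^sub>\<approx>z'\<in>?B - {0}. g (K z) z' - g k z' = 0"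
      using Rpos by (intro meromorphic_eq_0_if_germ_eq_0) auto
    then have "\<forall>\<^sub>F z' in at z. g (K z) z' - g k z' = 0"
      using K(2) z(2) by (intro eventually_cosparse_imp_eventually_at[of _ "?B - {0}"]) auto
    then show ?thesis
      unfolding F_def by (intro remove_sings_cong) auto
  qed
  have "F meromorphic_on {x}" if "x \<noteq> 0" for x
  proof -
    obtain k where k: "norm x < R k" using R(3) by blast
    have "\<forall>\<^sub>F z in at x. z \<in> ball 0 (R k) - {0}"
      by (rule eventually_at_in_open') (use that k in \<open>auto simp: open_delete\<close>)
    then have "\<forall>\<^sub>F z in at x. F z = remove_sings (g k) z"
      by eventually_elim (rule F_eq)
    moreover have "remove_sings (g k) meromorphic_on {x}"
      by (intro meromorphic_intros meromorphic_on_subset[OF assms(1)[of k]]) (use that k in auto)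
    ultimately show ?thesis
      using meromorphic_on_cong[of "{x}" F "remove_sings (g k)" "{x}"] by simp
  qed
  then have "F meromorphic_on (UNIV - {0})"
    using meromorphic_on_meromorphic_at[of F "UNIV - {0}"] by simp
  moreover have "\<forall>\<^sub>F z in punctured_germ. F z = f z"
  proof -
    let ?B = "ball (0::complex) (R 0)"
    have "\<forall>\<^sub>\<approx>z\<in>?B - {0}. z \<in> ?B - {0}"
      by (intro eventually_in_cosparse) (auto simp: open_delete)
    moreover have "\<forall>\<^sub>\<approx>z\<in>?B - {0}. remove_sings (g 0) z = g 0 z"
      by (rule eventually_remove_sings_eq[OF assms(1)])
    ultimately have "\<forall>\<^sub>\<approx>z\<in>?B - {0}. F z = g 0 z"
      by eventually_elim (use F_eq[of _ 0] in auto)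
    then have "\<forall>\<^sub>F z in punctured_germ. F z = g 0 z"
      using R(2) by (intro eventually_cosparse_imp_punctured_germ[of _ ?B]) auto
    then show ?thesis using assms(2)[of 0] by eventually_elim simp
  qed
  ultimately show ?thesis using that by blast
qed

text \<open>Discs whose radii grow by the factor \<open>norm q\<close> exhaust the plane, and the
  identity theorem carries the equation from the germ to the whole punctured plane.\<close>

lemma extend_solution:
  fixes q :: complex
  assumes q: "norm q > 1"
    and a: "\<And>i. i \<le> n \<Longrightarrow> a i meromorphic_on UNIV"
    and lead: "\<forall>\<^sub>F z in punctured_germ. a n z \<noteq> 0"
    and f: "mero_germ f"
    and eq: "\<forall>\<^sub>F z in punctured_germ. (\<Sum>i\<le>n. a i z * f (q ^ i * z)) = 0"
  obtains F where "F meromorphic_on (UNIV - {0})" "\<forall>\<^sub>F z in punctured_germ. F z = f z"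
    "\<forall>\<^sub>\<approx>z\<in>UNIV - {0}. (\<Sum>i\<le>n. a i z * F (q ^ i * z)) = 0"
proof -
  have q0: "q \<noteq> 0" using q by auto
  obtain e where e: "e > 0" "f meromorphic_on (ball 0 e - {0})"
    using f by (auto simp: mero_germ_alt)
  have eq_transfer: "\<forall>\<^sub>F z in punctured_germ. (\<Sum>i\<le>n. a i z * g (q ^ i * z)) = 0"
    if "\<forall>\<^sub>F z in punctured_germ. g z = f z" for g
  proof -
    have "\<forall>\<^sub>F z in punctured_germ. \<forall>i\<in>{..n}. g (q ^ i * z) = f (q ^ i * z)"
      by (intro eventually_ball_finite ballI eventually_punctured_germ_scale[OF _ that]) (use q0 in auto)
    with eq show ?thesis
      by eventually_elim simp
  qed
  have "\<exists>g. g meromorphic_on (ball 0 (norm q ^ k * e) - {0}) \<and> (\<forall>\<^sub>F z in punctured_germ. g z = f z)" for k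
  proof (induction k)
    case 0
    then show ?case using e by (intro exI[of _ f]) auto
  next
    case (Suc k)
    then obtain g where g: "g meromorphic_on (ball 0 (norm q ^ k * e) - {0})"
      "\<forall>\<^sub>F z in punctured_germ. g z = f z" by blast
    obtain g' where g': "g' meromorphic_on (ball 0 (norm q * (norm q ^ k * e)) - {0})"
      "\<forall>\<^sub>F z in punctured_germ. g' z = g z"
      by (rule extend_solution_step[OF q a lead g(1) eq_transfer[OF g(2)]])
    from g'(2) g(2) have "\<forall>\<^sub>F z in punctured_germ. g' z = f z" by eventually_elim simp
    with g'(1) show ?case by (auto simp: mult.assoc)
  qed
  then obtain g where g: "\<And>k. g k meromorphic_on (ball 0 (norm q ^ k * e) - {0})"
    "\<And>k. \<forall>\<^sub>F z in punctured_germ. g k z = f z" by metis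
  have R: "mono (\<lambda>k. norm q ^ k * e)" "norm q ^ 0 * e > 0" "\<exists>k. x < norm q ^ k * e" for x
  proof -
    show "mono (\<lambda>k. norm q ^ k * e)"
      using q e(1) by (intro monoI mult_right_mono power_increasing) auto
    obtain k where "x / e < norm q ^ k" using real_arch_pow[OF q] by blast
    then show "\<exists>k. x < norm q ^ k * e" using e(1) by (auto simp: field_simps)
  qed (use e in auto)
  obtain F where F: "F meromorphic_on (UNIV - {0})" "\<forall>\<^sub>F z in punctured_germ. F z = f z"
    by (rule extend_germ_if_all_balls[OF g R])
  have "(\<lambda>z. F (q ^ i * z)) meromorphic_on (UNIV - {0})" for i
    by (rule meromorphic_on_compose[OF F(1)]) (use q0 in \<open>auto intro: analytic_intros\<close>)
  then have "(\<lambda>z. \<Sum>i\<le>n. a i z * F (q ^ i * z)) meromorphic_on (UNIV - {0})"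
    using a by (intro meromorphic_intros) (auto intro: meromorphic_on_subset)
  then have "\<forall>\<^sub>\<approx>z\<in>UNIV - {0}. (\<Sum>i\<le>n. a i z * F (q ^ i * z)) = 0"
    by (rule meromorphic_eq_0_if_germ_eq_0) (use eq_transfer[OF F(2)] in auto)
  with F that show ?thesis by blast
qed

section \<open>Reduction to slope 0\<close>

lemma v0_eq_infinity_iff: "v0 f = \<infinity> \<longleftrightarrow> (\<forall>\<^sub>F z in at 0. f z = 0)"
  by (simp add: v0_def)

text \<open>With \<open>k\<close> the height of a supporting line, \<open>g 0\<close> records
  whether the Newton point lies on the line or above it; the zero germ counts as above.\<close>

lemma v0_factor:
  assumes "f meromorphic_on {0}" "ereal (of_int k) \<le> v0 f"
  obtains g where "g analytic_on {0}" "\<forall>\<^sub>F z in at 0. f z = z powi k * g z"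
    "g 0 = 0 \<longleftrightarrow> ereal (of_int k) < v0 f"
proof (cases "\<forall>\<^sub>F z in at 0. f z = 0")
  case True
  then show ?thesis
    by (intro that[of "\<lambda>_. 0"]) (auto simp: v0_def)
next
  case False
  obtain F where F: "f has_laurent_expansion F"
    using assms(1) unfolding meromorphic_on_def by auto
  have "F \<noteq> 0" using F False has_laurent_expansion_eventually_zero_iff[of f 0 F] by simp
  define N where "N = fls_subdegree F"
  define G where "G = eval_fps (fls_base_factor_to_fps F)"
  have "zorder f 0 = N" using has_laurent_expansion_zorder_0[OF F \<open>F \<noteq> 0\<close>] by (simp add: N_def)
  then have v0: "v0 f = ereal (of_int N)" using False by (simp add: v0_def)
  then have "k \<le> N" using assms(2) by simp
  have G: "G analytic_on {0}"
    using has_fps_expansion_fls_base_factor_to_fps[OF F]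
    unfolding G_def has_fps_expansion_def[of _ "fls_base_factor_to_fps F"]
    by (intro has_fps_expansion_imp_analytic_0[OF eval_fps_has_fps_expansion]) blast
  have fG: "\<forall>\<^sub>F z in at 0. f z = G z * z powi N"
    using F unfolding has_laurent_expansion_def eval_fls_def G_def N_def by (auto elim!: eventually_mono)
  have G0: "G 0 \<noteq> 0"
    using \<open>F \<noteq> 0\<close> by (simp add: G_def eval_fps_at_0)
  show ?thesis
  proof (rule that[of "\<lambda>z. z ^ nat (N - k) * G z"])
    show "(\<lambda>z. z ^ nat (N - k) * G z) analytic_on {0}" by (intro analytic_intros G)
    show "\<forall>\<^sub>F z in at 0. f z = z powi k * (z ^ nat (N - k) * G z)"
      using fG eventually_neq_at_within[of 0 0]
    proof eventually_elim
      case (elim z)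
      have "z powi (k + int m) = z powi k * z ^ m" for m
        using elim(2) by (simp add: power_int_add)
      from this[of "nat (N - k)"] have "z powi N = z powi k * z ^ nat (N - k)"
        using \<open>k \<le> N\<close> by simp
      then show ?case using elim(1) by (simp add: mult_ac)
    qed
    show "0 ^ nat (N - k) * G 0 = 0 \<longleftrightarrow> ereal (of_int k) < v0 f"
      using G0 \<open>k \<le> N\<close> by (auto simp: v0)
  qed
qed

lemma qshift_funpow: "(qshift q ^^ i) f z = f (q ^ i * z)"
  by (induction i arbitrary: z) (auto simp: qshift_def mult_ac)

lemma qdiff_op_eq: "qdiff_op q n a f z = (\<Sum>i\<le>n. a i z * f (q ^ i * z))"
  by (simp add: qdiff_op_def qshift_funpow)

text \<open>
  A power of \<open>theta\<close> tilts the Newton polygon so that its last slope becomes 0.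
\<close>

lemma integer_last_slope_solutions:
  fixes q :: complex and a :: "nat \<Rightarrow> complex \<Rightarrow> complex" and k V :: int
  assumes q: "norm q > 1" and a: "\<And>i. i \<le> n \<Longrightarrow> a i meromorphic_on {0}" and r: "r \<le> n"
    and above: "\<forall>i\<le>n. ereal (of_int (V - k * (int n - int i))) \<le> v0 (a i)"
    and right: "v0 (a n) = ereal (of_int V)"
    and left: "v0 (a (n - r)) = ereal (of_int (V - k * int r))"
    and strict: "\<forall>i<n - r. ereal (of_int (V - k * (int n - int i))) < v0 (a i)"
  obtains f where
    "\<forall>j<r. mero_germ (f j)"
    "\<forall>j<r. \<forall>\<^sub>F z in punctured_germ. (\<Sum>i\<le>n. a i z * f j (q ^ i * z)) = 0"
    "lin_indep_over_constants q (punctured nbhds_of_0) r f"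
proof -
  have q0: "q \<noteq> 0" using q by auto
  \<comment> \<open>The height over \<open>i\<close> of the line carrying the last edge.\<close>
  define e where "e i = V - k * (int n - int i)" for i
  have "\<exists>g. i \<le> n \<longrightarrow> g analytic_on {0} \<and> (\<forall>\<^sub>F z in at 0. a i z = z powi e i * g z) \<and>
      (g 0 = 0 \<longleftrightarrow> ereal (of_int (e i)) < v0 (a i))" for i
  proof (cases "i \<le> n")
    case True
    then have "ereal (of_int (e i)) \<le> v0 (a i)" using above by (simp add: e_def)
    then show ?thesis by (rule v0_factor[OF a[OF True]]) blast
  qed simp
  then have "\<exists>g. \<forall>i. i \<le> n \<longrightarrow> g i analytic_on {0} \<and>
      (\<forall>\<^sub>F z in at 0. a i z = z powi e i * g i z) \<and> (g i 0 = 0 \<longleftrightarrow> ereal (of_int (e i)) < v0 (a i))"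
    by (intro choice allI)
  then obtain g where g': "\<And>i. i \<le> n \<longrightarrow> g i analytic_on {0} \<and>
      (\<forall>\<^sub>F z in at 0. a i z = z powi e i * g i z) \<and> (g i 0 = 0 \<longleftrightarrow> ereal (of_int (e i)) < v0 (a i))"
    by blast
  have g: "\<And>i. i \<le> n \<Longrightarrow> g i analytic_on {0}"
    "\<And>i. i \<le> n \<Longrightarrow> \<forall>\<^sub>F z in at 0. a i z = z powi e i * g i z"
    "\<And>i. i \<le> n \<Longrightarrow> g i 0 = 0 \<longleftrightarrow> ereal (of_int (e i)) < v0 (a i)"
    using g' by auto
  define \<kappa> where "\<kappa> i = (\<Prod>j<i. (q ^ j) powi (- k))" for i
  \<comment> \<open>With this exponent, \<open>t (q ^ i * z)\<close> contributes
    \<open>z powi (- k * int i)\<close>, and \<open>e i - k * int i\<close> equals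
    \<open>V - k * int n\<close> for every \<open>i\<close>; \<open>\<kappa> i\<close> collects the
    constants of the iterated shift.\<close>
  define t where "t z = theta q z powi (- k)" for z
  have \<kappa>0: "\<kappa> i \<noteq> 0" for i using q0 by (simp add: \<kappa>_def)
  have t_scale: "t (q ^ i * z) = \<kappa> i * z powi (- k * int i) * t z" if "z \<noteq> 0" for i z
  proof (induction i)
    case (Suc i)
    have "t (q ^ Suc i * z) = (q ^ i * z) powi (- k) * t (q ^ i * z)"
      unfolding t_def using theta_powi_scale[OF q, of "q ^ i * z" "- k"] that q0 by (simp add: mult.assoc)
    also have "\<dots> = \<kappa> (Suc i) * (z powi (- k) * z powi (- k * int i)) * t z"
      unfolding Suc.IH by (simp add: \<kappa>_def power_int_mult_distrib mult_ac)
    also have "z powi (- k) * z powi (- k * int i) = z powi (- k * int (Suc i))"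
      using that by (subst power_int_add[symmetric]) (auto simp: algebra_simps)
    finally show ?case .
  qed (simp add: \<kappa>_def)
  have "\<exists>F. (\<forall>j<r. qspace q (F j) \<and> (\<forall>\<^sub>F z in punctured_germ. (\<Sum>i\<le>n. \<kappa> i * g i z * F j (q ^ i * z)) = 0)) \<and>
      lin_indep_over_constants q (punctured nbhds_of_0) r F"
  proof (rule normal_form_solutions[OF q r])
    show "(\<lambda>z. \<kappa> i * g i z) analytic_on {0}" if "i \<le> n" for i
      using g(1)[OF that] by (intro analytic_intros)
    show "\<kappa> n * g n 0 \<noteq> 0" using g(3)[of n] \<kappa>0 by (simp add: right e_def)
    show "\<kappa> (n - r) * g (n - r) 0 \<noteq> 0"
      using g(3)[of "n - r"] \<kappa>0 r by (simp add: left e_def of_nat_diff)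
    show "\<kappa> i * g i 0 = 0" if "i < n - r" for i
      using g(3)[of i] strict that by (simp add: e_def)
  qed
  then obtain F where F: "\<And>j. j < r \<Longrightarrow> qspace q (F j)"
    "\<And>j. j < r \<Longrightarrow> \<forall>\<^sub>F z in punctured_germ. (\<Sum>i\<le>n. \<kappa> i * g i z * F j (q ^ i * z)) = 0"
    "lin_indep_over_constants q (punctured nbhds_of_0) r F" by blast
  have mero: "mero_germ (\<lambda>z. t z * F j z)" if "j < r" for j
    unfolding t_def
    by (rule mero_germ_mult[OF mero_germ_powi[OF mero_germ_theta[OF q]] qspace_mero_germ[OF q F(1)[OF that]]])
  have sol: "\<forall>\<^sub>F z in punctured_germ. (\<Sum>i\<le>n. a i z * (t (q ^ i * z) * F j (q ^ i * z))) = 0" if "j < r" for j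
  proof -
    have "\<forall>\<^sub>F z in punctured_germ. \<forall>i\<in>{..n}. a i z = z powi e i * g i z"
      by (intro eventually_ball_finite ballI eventually_at_0_imp_punctured_germ g(2)) auto
    then show ?thesis using F(2)[OF that] eventually_neq_0_punctured_germ
    proof eventually_elim
      case (elim z)
      have "a i z * (t (q ^ i * z) * F j (q ^ i * z)) =
          z powi (V - k * int n) * t z * (\<kappa> i * g i z * F j (q ^ i * z))" if "i \<le> n" for i
      proof -
        have "z powi e i * z powi (- k * int i) = z powi (V - k * int n)"
          using elim(3) by (subst power_int_add[symmetric]) (auto simp: e_def algebra_simps)
        moreover have "a i z * (t (q ^ i * z) * F j (q ^ i * z)) =
          (z powi e i * z powi (- k * int i)) * t z * (\<kappa> i * g i z * F j (q ^ i * z))"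
          using elim(1) that unfolding t_scale[OF elim(3)] by (simp add: mult_ac)
        ultimately show ?thesis by simp
      qed
      then have "(\<Sum>i\<le>n. a i z * (t (q ^ i * z) * F j (q ^ i * z))) =
          z powi (V - k * int n) * t z * (\<Sum>i\<le>n. \<kappa> i * g i z * F j (q ^ i * z))"
        unfolding sum_distrib_left by (intro sum.cong) auto
      then show ?case using elim(2) by simp
    qed
  qed
  have "lin_indep_over_constants q (punctured nbhds_of_0) r (\<lambda>j z. t z * F j z)"
    unfolding lin_indep_punctured_nbhds_iff
  proof (intro allI impI)
    fix C j
    assume C: "\<forall>j<r. mero_germ (C j) \<and> (\<forall>\<^sub>F z in punctured_germ. C j (q * z) = C j z)"
      and zero: "\<forall>\<^sub>F z in punctured_germ. (\<Sum>j<r. C j z * (t z * F j z)) = 0" and j: "j < r"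
    have "\<forall>\<^sub>F z in punctured_germ. (\<Sum>j<r. C j z * F j z) = 0"
      using zero eventually_theta_nonzero[OF q]
    proof eventually_elim
      case (elim z)
      have "(\<Sum>j<r. C j z * (t z * F j z)) = t z * (\<Sum>j<r. C j z * F j z)"
        unfolding sum_distrib_left by (intro sum.cong) (auto simp: mult_ac)
      then show ?case using elim by (simp add: t_def)
    qed
    with C j show "\<forall>\<^sub>F z in punctured_germ. C j z = 0"
      using F(3)[unfolded lin_indep_punctured_nbhds_iff] by blast
  qed
  then show ?thesis
    by (intro that[of "\<lambda>j z. t z * F j z"]) (use mero sol in auto)
qed

text \<open>Besides translating the geometry into valuations, this shows that the description in
  \<open>slope_mult\<close> is proper: all edges of slope \<open>\<mu>\<close> end over
  \<open>n\<close> and start at the leftmost contact with the supporting line, so they have the same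
  width.\<close>

lemma last_slope_cases:
  fixes a :: "nat \<Rightarrow> complex \<Rightarrow> complex"
  assumes nz: "v0 (a n) \<noteq> \<infinity>" and int: "newton_slopes n a \<subseteq> \<int>"
    and \<mu>: "\<mu> \<in> newton_slopes n a" and max: "\<forall>\<nu>\<in>newton_slopes n a. \<nu> \<le> \<mu>"
  obtains r and k V :: int where "slope_mult n a \<mu> = r" "0 < r" "r \<le> n"
    "\<forall>i\<le>n. ereal (of_int (V - k * (int n - int i))) \<le> v0 (a i)"
    "v0 (a n) = ereal (of_int V)"
    "v0 (a (n - r)) = ereal (of_int (V - k * int r))"
    "\<forall>i<n - r. ereal (of_int (V - k * (int n - int i))) < v0 (a i)"
proof -
  define I where "I = {i. i \<le> n \<and> v0 (a i) \<noteq> \<infinity>}"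
  define w where "w i = zorder (a i) 0" for i
  have v0: "v0 (a i) = ereal (of_int (w i))" if "i \<in> I" for i
    using that by (auto simp: I_def w_def v0_def split: if_splits)
  have np: "newton_polygon n a = convex hull lattice_above I w"
  proof -
    have "{(real i, real_of_int j) | i j. i \<le> n \<and> v0 (a i) \<le> ereal (of_int j)} = lattice_above I w"
      unfolding lattice_above_def using v0 by (auto simp: I_def) (metis ereal_infty_less_eq(1) PInfty_neq_ereal(1) ereal_less_eq(3) of_int_le_iff)+
    then show ?thesis by (simp add: newton_polygon_def)
  qed
  have I: "finite I" "n \<in> I" "\<And>i. i \<in> I \<Longrightarrow> i \<le> n" using nz by (auto simp: I_def)
  have edges: "(r, d) \<in> newton_vectors n a \<longleftrightarrow>
      r > 0 \<and> (\<exists>p. closed_segment p (p + (real r, real_of_int d)) edge_of convex hull lattice_above I w)" for r d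
    by (auto simp: newton_vectors_def np)
  have facts: "r \<le> n \<and> n - r \<in> I \<and> w n - w (n - r) = d \<and>
      (\<forall>i\<in>I. w n - \<mu> * (real n - real i) \<le> w i) \<and>
      (\<forall>i\<in>I. i < n - r \<longrightarrow> w n - \<mu> * (real n - real i) < w i)"
    if rd: "(r, d) \<in> newton_vectors n a" "\<mu> = real_of_int d / real r" for r d
  proof -
    obtain p where p: "r > 0"
      "closed_segment p (p + (real r, real_of_int d)) edge_of convex hull lattice_above I w"
      using rd(1) by (auto simp: edges)
    have max': "real_of_int d' / real r' \<le> real_of_int d / real r"
      if "r' > 0" "closed_segment p' (p' + (real r', real_of_int d')) edge_of convex hull lattice_above I w"
      for p' r' d'
    proof -
      have "(r', d') \<in> newton_vectors n a" unfolding edges using that by blast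
      then show ?thesis unfolding rd(2)[symmetric] by (intro max[rule_format]) (auto simp: newton_slopes_def)
    qed
    note L = largest_slope_lattice_above[OF I p max']
    show ?thesis
      unfolding rd(2)
    proof (intro conjI ballI impI)
      show "r \<le> n" by (rule L(1))
      show "n - r \<in> I" by (rule L(2))
      show "w n - w (n - r) = d" by (rule L(3))
    next
      fix i assume i: "i \<in> I"
      show "w n - d / r * (real n - real i) \<le> w i" by (rule L(4)[OF _ _ _ i])
      show "w n - d / r * (real n - real i) < w i" if "i < n - r" by (rule L(5)[OF _ _ _ i that])
    qed
  qed
  obtain r d where rd: "(r, d) \<in> newton_vectors n a" "\<mu> = real_of_int d / real r"
    using \<mu> by (auto simp: newton_slopes_def)
  note F = facts[OF rd]
  have r0: "r > 0" using rd(1) by (simp add: edges)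
  \<comment> \<open>A wider edge would start on the line at an index left of the narrower edge,
    where the points lie strictly above the line.\<close>
  have uniq: "r2 \<le> r1" if "(r1, d1) \<in> newton_vectors n a" "\<mu> = real_of_int d1 / real r1"
    "(r2, d2) \<in> newton_vectors n a" "\<mu> = real_of_int d2 / real r2" for r1 d1 r2 d2
  proof (rule ccontr)
    assume "\<not> r2 \<le> r1"
    note f1 = facts[OF that(1,2)] and f2 = facts[OF that(3,4)]
    have "n - r2 < n - r1" using \<open>\<not> r2 \<le> r1\<close> f2 by linarith
    then have "w n - \<mu> * (real n - real (n - r2)) < w (n - r2)" using f1 f2 by blast
    moreover have "real n - real (n - r2) = r2" using f2 by (simp add: of_nat_diff)
    moreover have "\<mu> * r2 = d2" using that(3,4) by (simp add: edges)
    moreover have "real_of_int (w n) - w (n - r2) = d2" using f2 by (metis of_int_diff)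
    ultimately show False by simp
  qed
  have "slope_mult n a \<mu> = r"
    unfolding slope_mult_def
  proof (rule the_equality)
    show "\<exists>d. (r, d) \<in> newton_vectors n a \<and> \<mu> = real_of_int d / real r" using rd by blast
    show "r' = r" if "\<exists>d. (r', d) \<in> newton_vectors n a \<and> \<mu> = real_of_int d / real r'" for r'
      using that rd uniq by (metis antisym)
  qed
  \<comment> \<open>Integrality of \<open>\<mu>\<close> enters here: it makes the heights of the
    line integers and lets \<open>k\<close> serve as an exponent of theta.\<close>
  moreover obtain k where k: "\<mu> = real_of_int k"
    using \<mu> int by (auto elim!: Ints_cases)
  define V where "V = w n"
  have line: "V - \<mu> * (real n - real i) = real_of_int (V - k * (int n - int i))" for i
    by (simp add: k)
  have "ereal (of_int (V - k * (int n - int i))) \<le> v0 (a i)" if "i \<le> n" for i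
  proof (cases "i \<in> I")
    case True
    then have "V - \<mu> * (real n - real i) \<le> w i" using F by (simp add: V_def)
    then show ?thesis unfolding line by (simp add: v0[OF True])
  qed (use that in \<open>simp add: I_def\<close>)
  moreover have "ereal (of_int (V - k * (int n - int i))) < v0 (a i)" if "i < n - r" for i
  proof (cases "i \<in> I")
    case True
    then have "V - \<mu> * (real n - real i) < w i" using F that by (simp add: V_def)
    then show ?thesis unfolding line by (simp add: v0[OF True])
  qed (use that in \<open>simp add: I_def\<close>)
  moreover have "v0 (a n) = ereal (of_int V)" using v0[OF I(2)] by (simp add: V_def)
  moreover have "v0 (a (n - r)) = ereal (of_int (V - k * int r))"
  proof -
    have "real_of_int d = real_of_int (k * int r)" using rd(2) r0 by (simp add: k field_simps)
    then have "d = k * int r" using of_int_eq_iff by blast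
    then have "w (n - r) = V - k * int r" using F by (simp add: V_def)
    then show ?thesis using v0 F by simp
  qed
  ultimately show ?thesis using that[of r V k] r0 F by blast
qed

lemma mero_eq_nbhds_0I:
  assumes "\<forall>\<^sub>F z in at 0. f z = g z"
  shows "mero_eq nbhds_of_0 f g"
proof -
  obtain e where e: "e > 0" "\<And>z. z \<noteq> 0 \<Longrightarrow> dist z 0 < e \<Longrightarrow> f z = g z"
    using assms unfolding eventually_at by auto
  have "\<forall>\<^sub>F z in at x. f z = g z" if "x \<in> ball 0 e" for x
  proof (cases "x = 0")
    case False
    have "\<forall>\<^sub>F z in at x. z \<in> ball 0 e - {0}"
      by (rule eventually_at_in_open') (use that False in \<open>auto simp: open_delete\<close>)
    then show ?thesis by eventually_elim (auto intro: e)
  qed (use assms in simp)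
  then have "\<forall>\<^sub>\<approx>z\<in>ball 0 e. f z = g z" by (simp add: eventually_cosparse_open_eq)
  then show ?thesis using e(1) by (auto simp: mero_eq_def nbhds_of_0_def intro!: exI[of _ "ball 0 e"])
qed

lemma mero_eq_whole_plane_0I:
  assumes "f meromorphic_on UNIV" "\<forall>\<^sub>F z in at 0. f z = 0"
  shows "mero_eq whole_plane f (\<lambda>_. 0)"
proof -
  have "(\<forall>\<^sub>\<approx>z. f z = 0) \<or> (\<forall>\<^sub>\<approx>z. f z \<noteq> 0)"
    using assms(1) by (intro meromorphic_imp_constant_or_avoid) auto
  moreover have False if "\<forall>\<^sub>\<approx>z. f z \<noteq> 0"
  proof -
    have "\<forall>\<^sub>F z in at 0. f z \<noteq> 0" using eventually_cosparse_imp_eventually_at[OF that, of 0 UNIV] by simp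
    with assms(2) have "\<forall>\<^sub>F z in at (0::complex). False" by eventually_elim simp
    then show False by simp
  qed
  ultimately show ?thesis by (auto simp: mero_eq_def whole_plane_def)
qed

theorem mainTheorem5:
  fixes q :: complex and n :: nat and a :: "nat \<Rightarrow> complex \<Rightarrow> complex"
    and \<D> :: "complex set set" and \<mu> :: real
  assumes "norm q > 1"
    and "\<D> = whole_plane \<or> \<D> = nbhds_of_0"
    and "\<And>i. i \<le> n \<Longrightarrow> a i \<in> mero \<D>"
    and "\<not> mero_eq \<D> (a 0) (\<lambda>z. 0)" and "\<not> mero_eq \<D> (a n) (\<lambda>z. 0)"
    and "newton_slopes n a \<subseteq> \<int>"
    and "\<mu> \<in> newton_slopes n a" and "\<And>\<nu>. \<nu> \<in> newton_slopes n a \<Longrightarrow> \<nu> \<le> \<mu>"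
  shows "\<exists>f :: nat \<Rightarrow> complex \<Rightarrow> complex.
           (\<forall>j < slope_mult n a \<mu>. f j \<in> mero (punctured \<D>) \<and>
              mero_eq (punctured \<D>) (qdiff_op q n a (f j)) (\<lambda>z. 0)) \<and>
           lin_indep_over_constants q (punctured \<D>) (slope_mult n a \<mu>) f"
proof -
  have a0: "a i meromorphic_on {0}" if "i \<le> n" for i
    using assms(2) assms(3)[OF that]
    by (auto simp: mero_def whole_plane_def nbhds_of_0_def intro: meromorphic_on_subset)
  \<comment> \<open>In the global case, a leading coefficient that vanishes near 0 vanishes
    everywhere by the identity theorem.\<close>
  have an: "v0 (a n) \<noteq> \<infinity>"
  proof
    assume "v0 (a n) = \<infinity>"
    then have zero: "\<forall>\<^sub>F z in at 0. a n z = 0" by (simp add: v0_eq_infinity_iff)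
    have "mero_eq \<D> (a n) (\<lambda>z. 0)"
      using assms(2)
    proof
      assume "\<D> = whole_plane"
      then show ?thesis
        using assms(3)[of n] zero mero_eq_whole_plane_0I by (auto simp: mero_def whole_plane_def)
    qed (use zero mero_eq_nbhds_0I in auto)
    with assms(5) show False ..
  qed
  have max: "\<forall>\<nu>\<in>newton_slopes n a. \<nu> \<le> \<mu>" using assms(8) by blast
  obtain r and k V :: int where r: "slope_mult n a \<mu> = r" "0 < r" "r \<le> n"
    and v: "\<forall>i\<le>n. ereal (of_int (V - k * (int n - int i))) \<le> v0 (a i)"
      "v0 (a n) = ereal (of_int V)" "v0 (a (n - r)) = ereal (of_int (V - k * int r))"
      "\<forall>i<n - r. ereal (of_int (V - k * (int n - int i))) < v0 (a i)"
    by (rule last_slope_cases[OF an assms(6,7) max])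
  obtain f where f': "\<forall>j<r. mero_germ (f j)"
    "\<forall>j<r. \<forall>\<^sub>F z in punctured_germ. (\<Sum>i\<le>n. a i z * f j (q ^ i * z)) = 0"
    and f3: "lin_indep_over_constants q (punctured nbhds_of_0) r f"
    by (rule integer_last_slope_solutions[OF assms(1) a0 r(3) v])
  have f: "\<And>j. j < r \<Longrightarrow> mero_germ (f j)"
    "\<And>j. j < r \<Longrightarrow> \<forall>\<^sub>F z in punctured_germ. (\<Sum>i\<le>n. a i z * f j (q ^ i * z)) = 0"
    "lin_indep_over_constants q (punctured nbhds_of_0) r f"
    using f' f3 by auto
  from assms(2) show ?thesis
  proof
    assume D: "\<D> = nbhds_of_0"
    show ?thesis
      unfolding r(1) D mero_punctured_nbhds_iff mero_eq_punctured_nbhds_iff qdiff_op_eq using f by blast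
  next
    assume D: "\<D> = whole_plane"
    have D': "punctured \<D> = {UNIV - {0}}" by (simp add: D punctured_def whole_plane_def)
    have a: "a i meromorphic_on UNIV" if "i \<le> n" for i
      using assms(3)[OF that] by (simp add: D mero_def whole_plane_def)
    have lead: "\<forall>\<^sub>F z in punctured_germ. a n z \<noteq> 0"
    proof -
      have "\<not> (\<forall>\<^sub>\<approx>z. a n z = 0)" using assms(5) by (simp add: D mero_eq_def whole_plane_def)
      then have "\<forall>\<^sub>\<approx>z. a n z \<noteq> 0"
        using meromorphic_imp_constant_or_avoid[OF a[of n], of 0] by auto
      then have "\<forall>\<^sub>\<approx>z\<in>UNIV - {0}. a n z \<noteq> 0"
        by (auto simp: eventually_cosparse_open_eq open_delete)
      then show ?thesis by (rule eventually_cosparse_imp_punctured_germ) auto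
    qed
    have "\<exists>F. j < r \<longrightarrow> F meromorphic_on (UNIV - {0}) \<and> (\<forall>\<^sub>F z in punctured_germ. F z = f j z) \<and>
        (\<forall>\<^sub>\<approx>z\<in>UNIV - {0}. (\<Sum>i\<le>n. a i z * F (q ^ i * z)) = 0)" for j
    proof (cases "j < r")
      case True
      show ?thesis
        by (rule extend_solution[OF assms(1) a lead f(1)[OF True] f(2)[OF True]]) blast+
    qed simp
    then have "\<exists>F. \<forall>j. j < r \<longrightarrow> F j meromorphic_on (UNIV - {0}) \<and>
        (\<forall>\<^sub>F z in punctured_germ. F j z = f j z) \<and>
        (\<forall>\<^sub>\<approx>z\<in>UNIV - {0}. (\<Sum>i\<le>n. a i z * F j (q ^ i * z)) = 0)"
      by (intro choice allI)
    then obtain F where F: "\<And>j. j < r \<Longrightarrow> F j meromorphic_on (UNIV - {0})"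
      "\<And>j. j < r \<Longrightarrow> \<forall>\<^sub>F z in punctured_germ. F j z = f j z"
      "\<And>j. j < r \<Longrightarrow> \<forall>\<^sub>\<approx>z\<in>UNIV - {0}. (\<Sum>i\<le>n. a i z * F j (q ^ i * z)) = 0" by blast
    have germ: "eventually P punctured_germ" if "eventually P (cosparse (UNIV - {0}))" for P
      using that by (rule eventually_cosparse_imp_punctured_germ) auto
    \<comment> \<open>Global constants restrict to constants of the germ field and
      \<open>F j\<close> has the germ of \<open>f j\<close>, so a relation can be read near 0. The
      identity theorem then lifts the vanishing of the \<open>c j\<close> back to the punctured
      plane.\<close>
    have "lin_indep_over_constants q (punctured \<D>) r F"
      unfolding lin_indep_over_constants_def
    proof (intro allI impI)
      fix c j
      assume "(\<forall>j<r. c j \<in> q_constants q (punctured \<D>)) \<and>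
        mero_eq (punctured \<D>) (\<lambda>z. \<Sum>j<r. c j z * F j z) (\<lambda>z. 0)" and j: "j < r"
      then have c: "\<And>j. j < r \<Longrightarrow> c j meromorphic_on (UNIV - {0})"
        "\<And>j. j < r \<Longrightarrow> \<forall>\<^sub>F z in punctured_germ. c j (q * z) = c j z"
        "\<forall>\<^sub>F z in punctured_germ. (\<Sum>j<r. c j z * F j z) = 0"
        by (auto simp: D' q_constants_def mero_def mero_eq_def qshift_def intro: germ)
      have "\<forall>\<^sub>F z in punctured_germ. \<forall>j\<in>{..<r}. F j z = f j z"
        by (intro eventually_ball_finite ballI F(2)) auto
      with c(3) have "\<forall>\<^sub>F z in punctured_germ. (\<Sum>j<r. c j z * f j z) = 0"
        by eventually_elim simp
      moreover have "mero_germ (c j)" if "j < r" for j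
        using c(1)[OF that] by (rule meromorphic_on_imp_mero_germ) auto
      ultimately have "\<forall>\<^sub>F z in punctured_germ. c j z = 0"
        using f(3)[unfolded lin_indep_punctured_nbhds_iff] c(2) j by blast
      then have "\<forall>\<^sub>\<approx>z\<in>UNIV - {0}. c j z = 0"
        using c(1)[OF j] by (intro meromorphic_eq_0_if_germ_eq_0) auto
      then show "mero_eq (punctured \<D>) (c j) (\<lambda>z. 0)" by (simp add: D' mero_eq_def)
    qed
    then show ?thesis
      unfolding r(1) using F(1,3) by (intro exI[of _ F]) (auto simp: D' mero_def mero_eq_def qdiff_op_eq)
  qed
qed

end
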